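(* Let $G\subseteq\mathbb{C}$ be a domain and let $\Phi_G$ be the family of all (densities of) SK-metrics on $G$. If $\Phi_G\neq\emptyset$, then $$\lambda_G(z):=\sup_{\lambda\in\Phi_G}\lambda(z)$$ induces a regular conformal metric $\lambda_G(z)\,|dz|$ of constant curvature $-1$ on $G$. In particular, $\lambda_G(z)\,|dz|$ is the (unique) maximal SK-metric on $G$.
   Context: A conformal pseudo-metric $\lambda(z)\,|dz|$ on $G$ is given by a continuous function $\lambda:G\to[0,+\infty)$, $\lambda\not\equiv 0$ (its density); it is a conformal metric if $\lambda>0$ on $G$, and it is regular if $\lambda$ is of class $C^2$ on $\{\lambda>0\}$. For a continuous real-valued function $u$ near a point $z$, the generalized lower Laplace operator is $\Delta u(z)=\liminf_{r\to 0}\frac{4}{r^2}\left(\frac{1}{2\pi}\int_0^{2\pi}u(z+re^{it})\,dt-u(z)\right)$ (equal to the usual Laplacian if $u$ is $C^2$ near $z$). Where $\lambda(z)>0$ the curvature is $\kappa_\lambda(z)=-\Delta(\log\lambda)(z)/\lambda(z)^2$. The pseudo-metric $\lambda(z)\,|dz|$ is an SK-metric on $G$ if $\kappa_\lambda\le -1$ at every point where $\lambda>0$. An SK-metric is maximal if its density dominates pointwise the density of every SK-metric on $G$. *)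

theory Defs
  imports "HOL-Analysis.Analysis"
begin

text \<open>
  The density of a (pseudo-)metric on \<open>G\<close> is a function on the whole plane of which only the
  values on \<open>G\<close> matter.
\<close>

definition conformal_pseudo_metric :: "complex set \<Rightarrow> (complex \<Rightarrow> real) \<Rightarrow> bool" where
  "conformal_pseudo_metric G l \<longleftrightarrow>
     continuous_on G l \<and> (\<forall>z\<in>G. l z \<ge> 0) \<and> (\<exists>z\<in>G. l z \<noteq> 0)"

definition conformal_metric :: "complex set \<Rightarrow> (complex \<Rightarrow> real) \<Rightarrow> bool" where
  "conformal_metric G l \<longleftrightarrow> conformal_pseudo_metric G l \<and> (\<forall>z\<in>G. l z > 0)"

text \<open>Class \<open>C\<^sup>2\<close> in the real sense (complex numbers as a real normed space); meant for open \<open>S\<close>.\<close>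

definition C2_on :: "'a::real_normed_vector set \<Rightarrow> ('a \<Rightarrow> 'b::real_normed_vector) \<Rightarrow> bool" where
  "C2_on S f \<longleftrightarrow>
     (\<exists>(f' :: 'a \<Rightarrow> 'a \<Rightarrow>\<^sub>L 'b) (f'' :: 'a \<Rightarrow> 'a \<Rightarrow>\<^sub>L 'a \<Rightarrow>\<^sub>L 'b).
        (\<forall>x\<in>S. (f has_derivative blinfun_apply (f' x)) (at x)) \<and>
        (\<forall>x\<in>S. (f' has_derivative blinfun_apply (f'' x)) (at x)) \<and>
        continuous_on S f'')"

definition regular_pseudo_metric :: "complex set \<Rightarrow> (complex \<Rightarrow> real) \<Rightarrow> bool" where
  "regular_pseudo_metric G l \<longleftrightarrow>
     conformal_pseudo_metric G l \<and> C2_on {z\<in>G. l z > 0} l"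

text \<open>
  The lower limit may be infinite, hence the extended reals; for \<open>u\<close> continuous near \<open>z\<close> the
  integrals exist for all small \<open>r > 0\<close>.
\<close>

definition lower_laplacian :: "(complex \<Rightarrow> real) \<Rightarrow> complex \<Rightarrow> ereal" where
  "lower_laplacian u z =
     Liminf (at_right 0) (\<lambda>r::real. ereal (4 / r\<^sup>2 *
       (1 / (2 * pi) * integral {0..2 * pi} (\<lambda>t. u (z + of_real r * exp (\<i> * of_real t))) - u z)))"

text \<open>Only meaningful at points where \<open>l\<close> is positive.\<close>

definition curvature :: "(complex \<Rightarrow> real) \<Rightarrow> complex \<Rightarrow> ereal" where
  "curvature l z = - lower_laplacian (\<lambda>w. ln (l w)) z / ereal ((l z)\<^sup>2)"

definition SK_metric :: "complex set \<Rightarrow> (complex \<Rightarrow> real) \<Rightarrow> bool" where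
  "SK_metric G l \<longleftrightarrow>
     conformal_pseudo_metric G l \<and> (\<forall>z\<in>G. l z > 0 \<longrightarrow> curvature l z \<le> -1)"

definition SK_metrics :: "complex set \<Rightarrow> (complex \<Rightarrow> real) set" where
  "SK_metrics G = {l. SK_metric G l}"

definition maximal_SK_metric :: "complex set \<Rightarrow> (complex \<Rightarrow> real) \<Rightarrow> bool" where
  "maximal_SK_metric G l \<longleftrightarrow>
     SK_metric G l \<and> (\<forall>m. SK_metric G m \<longrightarrow> (\<forall>z\<in>G. m z \<le> l z))"

text \<open>
  A supremum of reals, so it is only meaningful together with boundedness of the family at \<open>z\<close>.
\<close>

definition sup_SK :: "complex set \<Rightarrow> complex \<Rightarrow> real" where
  "sup_SK G z = (SUP l\<in>SK_metrics G. l z)"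

end

theory Submission
  imports Defs "HOL-Complex_Analysis.Complex_Analysis"
begin

text \<open>
  Write \<open>u = ln l\<close>. A density \<open>l\<close> is an SK-metric when \<open>u\<close> is a subsolution of Liouville's
  equation \<open>\<Delta> u = exp (2 u)\<close>, so the supremum of all SK-metrics is the Perron solution of that
  equation. Perron's method needs an a priori bound, local solvability of the Dirichlet problem
  with a comparison principle, and compactness and regularity of solutions. Every
  solution that occurs is given by Liouville's formula
  \<open>l = 2 |F'| / (1 - |F|^2)\<close> with \<open>F\<close> holomorphic into the unit disc, and questions about
  solutions become questions about \<open>F\<close>.

  The a priori bound is Ahlfors' lemma (\<open>ahlfors_lemma\<close>), which bounds an SK-metric on a disc by
  the hyperbolic metric of that disc. It allows one to work on discs whose radius \<open>R\<close> is so small that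
  \<open>R * l\<close> is small for every SK-metric \<open>l\<close>.

  For such small boundary values the Dirichlet problem is a nonlinear Riemann-Hilbert problem: find
  \<open>F\<close> with \<open>F 0 = 0\<close> such that \<open>ln |F'| = ln (\<phi> / 2) + ln (1 - |F|^2)\<close> on the circle. Given \<open>F\<close> on
  the right, let \<open>g\<close> be the holomorphic function whose real part has these boundary values, and
  take the primitive of \<open>exp g\<close> as the new \<open>F\<close>. Conjugation is unbounded in the sup norm, so \<open>g\<close> is
  controlled only up to a logarithm near the circle; the logarithm is integrable, and integrating
  \<open>exp g\<close> turns this map into a sup-norm contraction (\<open>riemann_hilbert_step_contraction\<close>). The fixed
  point satisfies \<open>F' = exp g\<close>, so \<open>F'\<close> has no zeros and the metric is regular at once
  (\<open>liouville_dirichlet\<close>).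

  Compactness of solutions is Montel's theorem for \<open>F\<close>, and by Hurwitz's theorem a limit of
  solutions is positive everywhere or zero everywhere (\<open>liouville_family_compact\<close>). So one can
  enlarge any SK-metric to one that is a Liouville density on a given small disc
  (\<open>SK_metric_modification\<close>). Doing this along a sequence that exhausts the supremum on a countable
  dense set shows that the supremum itself is a Liouville density on small discs
  (\<open>sup_SK_locally_liouville\<close>). Regularity and curvature \<open>-1\<close> can be read off from the formula, and
  positivity propagates by the dichotomy positive or zero, because \<open>G\<close> is connected.
\<close>

section \<open>The lower Laplace operator\<close>

text \<open>
  Only differences from the value at the centre enter, and circle means are monotone. The maximum
  principle and the gluing of subsolutions both reduce to this.
\<close>

lemma lower_laplacian_mono:
  assumes e: "e > 0" and u: "continuous_on (ball z e) u" and v: "continuous_on (ball z e) v"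
    and le: "\<And>w. w \<in> ball z e \<Longrightarrow> u w - u z \<le> v w - v z"
  shows "lower_laplacian u z \<le> lower_laplacian v z"
  unfolding lower_laplacian_def
proof (rule Liminf_mono)
  have "\<forall>\<^sub>F r in at_right 0. r < e" "\<forall>\<^sub>F r in at_right 0. 0 < (r::real)"
    using e by (auto simp: eventually_at_right_field)
  then show "\<forall>\<^sub>F r in at_right 0.
      ereal (4 / r\<^sup>2 * (1 / (2 * pi) * integral {0..2 * pi} (\<lambda>t. u (z + of_real r * exp (\<i> * of_real t))) - u z))
      \<le> ereal (4 / r\<^sup>2 * (1 / (2 * pi) * integral {0..2 * pi} (\<lambda>t. v (z + of_real r * exp (\<i> * of_real t))) - v z))"
  proof eventually_elim
    case (elim r)
    define p where "p t = z + of_real r * exp (\<i> * of_real t)" for t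
    have p: "p t \<in> ball z e" for t
      using elim by (simp add: p_def dist_norm norm_mult)
    have pc: "continuous_on {0..2*pi} p"
      unfolding p_def by (intro continuous_intros)
    have int: "(\<lambda>t. h (p t)) integrable_on {0..2*pi}" if "continuous_on (ball z e) h"
      for h :: "complex \<Rightarrow> real"
      by (intro integrable_continuous_interval continuous_on_compose2[OF that pc]) (use p in auto)
    have "integral {0..2*pi} (\<lambda>t. u (p t)) \<le> integral {0..2*pi} (\<lambda>t. v (p t) + (u z - v z))"
      by (rule integral_le[OF int[OF u] integrable_add[OF int[OF v] integrable_const_ivl]])
        (use le[OF p] in \<open>simp add: algebra_simps\<close>)
    also have "\<dots> = integral {0..2*pi} (\<lambda>t. v (p t)) + 2 * pi * (u z - v z)"
      by (subst integral_add) (use int[OF v] in auto)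
    finally have "integral {0..2*pi} (\<lambda>t. u (p t)) / (2 * pi)
        \<le> (integral {0..2*pi} (\<lambda>t. v (p t)) + 2 * pi * (u z - v z)) / (2 * pi)"
      by (rule divide_right_mono) simp
    then have "1 / (2 * pi) * integral {0..2*pi} (\<lambda>t. u (p t)) - u z
        \<le> 1 / (2 * pi) * integral {0..2*pi} (\<lambda>t. v (p t)) - v z"
      by (simp add: add_divide_distrib)
    then show ?case
      unfolding p_def ereal_less_eq by (intro mult_left_mono) auto
  qed
qed

lemma holomorphic_circle_mean:
  assumes "g holomorphic_on ball z e" "0 < r" "r < e"
  shows "((\<lambda>t. g (z + of_real r * exp (\<i> * of_real t))) has_integral 2 * of_real pi * g z) {0..2*pi}"
proof -
  have "g holomorphic_on cball z r"
    using assms by (auto intro: holomorphic_on_subset)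
  then have "((\<lambda>u. g u / (u - z)) has_contour_integral (2 * of_real pi * \<i> * g z)) (circlepath z r)"
    using assms by (intro Cauchy_integral_circlepath)
      (auto intro: holomorphic_on_imp_continuous_on holomorphic_on_subset)
  then have "((\<lambda>t. g (z + r * cis t) / (z + r * cis t - z) * r * \<i> * cis t)
      has_integral (2 * of_real pi * \<i> * g z)) {0..2*pi}"
    unfolding circlepath_def by (subst (asm) has_contour_integral_part_circlepath_iff) auto
  then have "((\<lambda>t. \<i> * g (z + r * cis t)) has_integral (\<i> * (2 * of_real pi * g z))) {0..2*pi}"
    using \<open>0 < r\<close> by (simp add: mult_ac)
  then have "((\<lambda>t. - \<i> * (\<i> * g (z + r * cis t))) has_integral (- \<i> * (\<i> * (2 * of_real pi * g z)))) {0..2*pi}"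
    by (rule has_integral_mult_right)
  then show ?thesis
    by (simp add: cis_conv_exp)
qed

text \<open>
  The circle mean of \<open>Re g\<close> is exactly \<open>Re (g z)\<close>, so only \<open>v\<close> contributes, and its mean over the
  circle of radius \<open>r\<close> is \<open>L * r^2\<close> up to \<open>o(r^2)\<close>.
\<close>

lemma lower_laplacian_harmonic_plus_quadratic:
  assumes e: "e > 0" and g: "g holomorphic_on ball z e" and v: "continuous_on (ball z e) v"
    and v0: "v z = 0" and lim: "((\<lambda>w. v w / (cmod (w - z))\<^sup>2) \<longlongrightarrow> L) (at z)"
    and u: "\<And>w. w \<in> ball z e \<Longrightarrow> u w = Re (g w) + v w"
  shows "lower_laplacian u z = ereal (4 * L)"
  unfolding lower_laplacian_def
proof (rule lim_imp_Liminf)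
  show "((\<lambda>r. ereal (4 / r\<^sup>2 * (1 / (2 * pi) * integral {0..2 * pi}
      (\<lambda>t. u (z + of_real r * exp (\<i> * of_real t))) - u z))) \<longlongrightarrow> ereal (4 * L)) (at_right 0)"
    (is "((\<lambda>r. ereal (?Q r)) \<longlongrightarrow> _) _")
  proof (intro tendsto_ereal tendstoI)
    fix \<epsilon> :: real assume "\<epsilon> > 0"
    then obtain d where d: "d > 0"
      "\<And>w. w \<noteq> z \<Longrightarrow> dist w z < d \<Longrightarrow> \<bar>v w / (cmod (w - z))\<^sup>2 - L\<bar> < \<epsilon> / 8"
      using lim[THEN tendstoD, of "\<epsilon>/8"] by (auto simp: eventually_at dist_real_def)
    have "\<forall>\<^sub>F r in at_right 0. r < e" "\<forall>\<^sub>F r in at_right 0. r < d" "\<forall>\<^sub>F r in at_right 0. 0 < (r::real)"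
      using e d by (auto simp: eventually_at_right_field)
    then show "\<forall>\<^sub>F r in at_right 0. dist (?Q r) (4 * L) < \<epsilon>"
    proof eventually_elim
      case (elim r)
      define p where "p t = z + of_real r * exp (\<i> * of_real t)" for t
      have p: "p t \<in> ball z e" "p t \<noteq> z" "dist (p t) z < d" "cmod (p t - z) = r" for t
        using elim by (auto simp: p_def dist_norm norm_mult)
      have pc: "continuous_on {0..2*pi} p"
        unfolding p_def by (intro continuous_intros)
      have vc: "continuous_on {0..2*pi} (\<lambda>t. v (p t))"
        by (intro continuous_on_compose2[OF v pc]) (use p in auto)
      have "((\<lambda>t. Re (g (p t))) has_integral 2 * pi * Re (g z)) {0..2*pi}"
        using has_integral_Re[OF holomorphic_circle_mean[OF g]] elim by (simp add: p_def)
      moreover have "((\<lambda>t. v (p t)) has_integral integral {0..2*pi} (\<lambda>t. v (p t))) {0..2*pi}"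
        using integrable_continuous_interval[OF vc] by blast
      ultimately have "((\<lambda>t. u (p t)) has_integral
          2 * pi * Re (g z) + integral {0..2*pi} (\<lambda>t. v (p t))) {0..2*pi}"
        by (rule has_integral_eq[rotated, OF has_integral_add]) (use u p in auto)
      then have iu: "integral {0..2*pi} (\<lambda>t. u (p t)) = 2 * pi * Re (g z) + integral {0..2*pi} (\<lambda>t. v (p t))"
        by (rule integral_unique)
      have "u z = Re (g z)"
        using u[of z] e v0 by simp
      with iu have Q: "?Q r = 4 / r\<^sup>2 * (1 / (2*pi)) * integral {0..2*pi} (\<lambda>t. v (p t))"
        unfolding p_def by (simp add: field_simps)
      have "norm (integral {0..2*pi} (\<lambda>t. v (p t) - L * r\<^sup>2)) \<le> (\<epsilon> / 8 * r\<^sup>2) * (2*pi - 0)"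
      proof (rule integral_bound)
        show "norm (v (p t) - L * r\<^sup>2) \<le> \<epsilon> / 8 * r\<^sup>2" for t
        proof -
          have "\<bar>v (p t) / r\<^sup>2 - L\<bar> * r\<^sup>2 \<le> \<epsilon> / 8 * r\<^sup>2"
            using d(2)[OF p(2,3)[of t]] unfolding p(4) by (intro mult_right_mono) auto
          also have "\<bar>v (p t) / r\<^sup>2 - L\<bar> * r\<^sup>2 = \<bar>(v (p t) / r\<^sup>2 - L) * r\<^sup>2\<bar>"
            by (simp add: abs_mult)
          also have "(v (p t) / r\<^sup>2 - L) * r\<^sup>2 = v (p t) - L * r\<^sup>2"
            using elim by (simp add: field_simps)
          finally show ?thesis by simp
        qed
      qed (use vc in \<open>auto intro!: continuous_intros\<close>)
      also have "integral {0..2*pi} (\<lambda>t. v (p t) - L * r\<^sup>2) = integral {0..2*pi} (\<lambda>t. v (p t)) - 2 * pi * L * r\<^sup>2"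
        by (subst integral_diff) (use integrable_continuous_interval[OF vc] in auto)
      finally have *: "\<bar>integral {0..2*pi} (\<lambda>t. v (p t)) - 2 * pi * L * r\<^sup>2\<bar> \<le> \<epsilon> / 8 * r\<^sup>2 * (2*pi)"
        by simp
      define k where "k = 4 / r\<^sup>2 * (1 / (2*pi))"
      have "k \<ge> 0" by (simp add: k_def)
      have "?Q r - 4 * L = k * (integral {0..2*pi} (\<lambda>t. v (p t)) - 2 * pi * L * r\<^sup>2)"
        using elim unfolding Q k_def by (simp add: field_simps)
      then have "\<bar>?Q r - 4 * L\<bar> = k * \<bar>integral {0..2*pi} (\<lambda>t. v (p t)) - 2 * pi * L * r\<^sup>2\<bar>"
        using \<open>k \<ge> 0\<close> by (simp only: abs_mult abs_of_nonneg)
      also have "\<dots> \<le> k * (\<epsilon> / 8 * r\<^sup>2 * (2*pi))"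
        by (intro mult_left_mono * \<open>k \<ge> 0\<close>)
      also have "\<dots> = \<epsilon> / 2"
        using elim by (simp add: k_def field_simps)
      finally show ?case
        using \<open>\<epsilon> > 0\<close> by (simp add: dist_real_def)
    qed
  qed
qed simp

section \<open>Liouville densities\<close>

text \<open>
  The pull-back under \<open>F\<close> of the hyperbolic metric of the unit disc.
\<close>

definition liouville_density :: "(complex \<Rightarrow> complex) \<Rightarrow> complex \<Rightarrow> real" where
  "liouville_density F z = 2 * cmod (deriv F z) / (1 - (cmod (F z))\<^sup>2)"

lemma half_disc_gap:
  assumes "cmod c \<le> 1/2"
  shows "3/4 \<le> 1 - (cmod c)\<^sup>2"
proof -
  have "(cmod c)\<^sup>2 \<le> (1/2)\<^sup>2" using assms by (intro power_mono) auto
  then show ?thesis by (simp add: power2_eq_square)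
qed

text \<open>
  The pull-back of \<open>1 - |w|^2\<close> under the disc automorphism \<open>a \<mapsto> (a - c) / (1 - cnj c * a)\<close>, cleared
  of denominators.
\<close>

lemma pseudo_hyperbolic_identity:
  fixes a c :: complex
  shows "(cmod (1 - cnj c * a))\<^sup>2 - (cmod (a - c))\<^sup>2 = (1 - (cmod c)\<^sup>2) * (1 - (cmod a)\<^sup>2)"
  unfolding cmod_power2 by (simp add: algebra_simps power2_eq_square)

text \<open>
  The value at \<open>0\<close> is filled in because the quotient is composed with functions that vanish at the
  point of interest and possibly near it.
\<close>

lemma minus_ln_one_minus_over_tendsto: "((\<lambda>x::real. if x = 0 then 1 else - ln (1 - x) / x) \<longlongrightarrow> 1) (nhds 0)"
proof -
  have "((\<lambda>x::real. - ln (1 - x)) has_real_derivative 1) (at 0)"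
    by (auto intro!: derivative_eq_intros)
  then have "((\<lambda>x::real. - ln (1 - x) / x) \<longlongrightarrow> 1) (at 0)"
    by (simp add: has_field_derivative_iff)
  then have "((\<lambda>x::real. if x = 0 then 1 else - ln (1 - x) / x) \<longlongrightarrow> 1) (at 0)"
    by (rule Lim_transform_eventually) (auto simp: eventually_at_filter)
  then show ?thesis
    by (simp add: tendsto_nhds_iff)
qed

text \<open>
  Let \<open>K\<close> be \<open>F\<close> followed by the disc automorphism that sends \<open>F z\<close> to \<open>0\<close>. The automorphism is a
  hyperbolic isometry, so the logarithm of the density is \<open>ln |q| - ln (1 - |K|^2)\<close> with \<open>q = 2 K'\<close>.
  The first term is harmonic near \<open>z\<close>, and the second one is \<open>|K' z|^2 * |w - z|^2\<close> to leading order.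
\<close>

lemma lower_laplacian_ln_liouville_density:
  assumes S: "open S" "z \<in> S" and F: "F holomorphic_on S"
    and lt: "\<And>w. w \<in> S \<Longrightarrow> cmod (F w) < 1" and nz: "deriv F z \<noteq> 0"
  shows "lower_laplacian (\<lambda>w. ln (liouville_density F w)) z = ereal ((liouville_density F z)\<^sup>2)"
proof -
  have F': "deriv F holomorphic_on S"
    using F S by (simp add: holomorphic_deriv)
  obtain e1 where e1: "e1 > 0" "ball z e1 \<subseteq> S"
    using S openE by blast
  have "isCont (deriv F) z"
    using F' S by (metis continuous_on_eq_continuous_at holomorphic_on_imp_continuous_on)
  then obtain e2 where e2: "e2 > 0" "\<And>w. dist z w < e2 \<Longrightarrow> deriv F w \<noteq> 0"
    using continuous_at_avoid[of z "deriv F" 0] nz by blast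
  define e where "e = min e1 e2"
  have e: "e > 0" "ball z e \<subseteq> S" "\<And>w. w \<in> ball z e \<Longrightarrow> deriv F w \<noteq> 0"
    using e1 e2 by (auto simp: e_def)
  define c where "c = F z"
  define m where "m w = 1 - cnj c * F w" for w
  define K where "K w = (F w - c) / m w" for w
  define q where "q w = 2 * deriv F w * of_real (1 - (cmod c)\<^sup>2) / (m w)\<^sup>2" for w
  have c1: "cmod c < 1" using lt S by (simp add: c_def)
  have sq1: "(cmod c)\<^sup>2 < 1"
    using c1 by (simp add: power_less_one_iff)
  have ltF: "(cmod (F w))\<^sup>2 < 1" if "w \<in> ball z e" for w
    using lt[of w] that e by (auto simp: power_less_one_iff)
  have mnz: "m w \<noteq> 0" if "w \<in> ball z e" for w
  proof
    assume "m w = 0"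
    then have "(1 - (cmod c)\<^sup>2) * (1 - (cmod (F w))\<^sup>2) = - (cmod (F w - c))\<^sup>2"
      using pseudo_hyperbolic_identity[of c "F w"] by (simp add: m_def)
    then have "(1 - (cmod c)\<^sup>2) * (1 - (cmod (F w))\<^sup>2) \<le> 0"
      by simp
    then show False
      using sq1 ltF[OF that] by (simp add: mult_le_0_iff)
  qed
  have K1: "1 - (cmod (K w))\<^sup>2 = (1 - (cmod c)\<^sup>2) * (1 - (cmod (F w))\<^sup>2) / (cmod (m w))\<^sup>2" if "w \<in> ball z e" for w
    using mnz[OF that] pseudo_hyperbolic_identity[of c "F w"]
    by (simp add: K_def norm_divide power_divide m_def[symmetric] field_simps)
  have Fb: "F holomorphic_on ball z e" and F'b: "deriv F holomorphic_on ball z e"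
    using F F' e holomorphic_on_subset by blast+
  have qh: "q holomorphic_on ball z e"
    unfolding q_def using mnz by (auto simp: m_def intro!: holomorphic_intros Fb F'b)
  have Kh: "K holomorphic_on ball z e"
    unfolding K_def using mnz by (auto simp: m_def intro!: holomorphic_intros Fb F'b)
  have sq1': "1 - (of_real (cmod c))\<^sup>2 \<noteq> (0::complex)"
    using sq1 by (metis less_irrefl of_real_eq_iff of_real_power of_real_1 eq_iff_diff_eq_0)
  have qnz: "q w \<noteq> 0" if "w \<in> ball z e" for w
    using mnz[OF that] e(3)[OF that] sq1' by (simp add: q_def)
  obtain g where g: "g holomorphic_on ball z e" "\<And>w. w \<in> ball z e \<Longrightarrow> q w = exp (g w)"
    using contractible_imp_holomorphic_log[OF qh convex_imp_contractible[OF convex_ball]] qnz by metis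
  define v where "v w = - ln (1 - (cmod (K w))\<^sup>2)" for w
  have Kpos: "0 < 1 - (cmod (K w))\<^sup>2" if "w \<in> ball z e" for w
    unfolding K1[OF that] using sq1 ltF[OF that] mnz[OF that] by simp
  have vc: "continuous_on (ball z e) v"
    unfolding v_def using Kpos
    by (intro continuous_intros holomorphic_on_imp_continuous_on[OF Kh]) (metis less_irrefl)
  have z: "z \<in> ball z e" using e by simp
  have dens: "ln (liouville_density F w) = Re (g w) + v w" if w: "w \<in> ball z e" for w
  proof -
    have "liouville_density F w = cmod (q w) / (1 - (cmod (K w))\<^sup>2)"
      using sq1 mnz[OF w] ltF[OF w] unfolding K1[OF w] liouville_density_def q_def
      by (simp add: norm_mult norm_divide norm_power del: of_real_diff of_real_power)
    moreover have "ln (cmod (q w)) = Re (g w)"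
      using g(2)[OF w] by simp
    ultimately show ?thesis
      using Kpos[OF w] qnz[OF w] by (simp add: v_def ln_div)
  qed
  have mz: "m z = of_real (1 - (cmod c)\<^sup>2)"
    unfolding m_def c_def by (simp only: of_real_diff complex_norm_square of_real_1) (simp add: mult.commute)
  have dF: "(F has_field_derivative deriv F z) (at z)"
    using Fb z by (simp add: holomorphic_derivI)
  have "((\<lambda>w. F w - c) has_field_derivative deriv F z) (at z)"
    by (auto intro!: derivative_eq_intros dF)
  moreover have "(m has_field_derivative - (cnj c * deriv F z)) (at z)"
    unfolding m_def by (auto intro!: derivative_eq_intros dF)
  ultimately have "(K has_field_derivative
      (deriv F z * m z - (F z - c) * - (cnj c * deriv F z)) / (m z * m z)) (at z)"
    unfolding K_def using mnz[OF z] by (rule DERIV_divide)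
  then have "(K has_field_derivative deriv F z / m z) (at z)"
    using mnz[OF z] by (simp add: c_def)
  then have "((\<lambda>w. (K w - K z) / (w - z)) \<longlongrightarrow> deriv F z / m z) (at z)"
    by (simp add: has_field_derivative_iff)
  moreover have "K z = 0" by (simp add: K_def c_def)
  ultimately have lim1: "((\<lambda>w. (cmod (K w / (w - z)))\<^sup>2) \<longlongrightarrow> (cmod (deriv F z / m z))\<^sup>2) (at z)"
    by (intro tendsto_power tendsto_norm) simp
  define \<rho> where "\<rho> x = (if x = 0 then 1 else - ln (1 - x) / x)" for x :: real
  have "isCont K z"
    using Kh z by (meson continuous_on_eq_continuous_at holomorphic_on_imp_continuous_on open_ball)
  then have "((\<lambda>w. (cmod (K w))\<^sup>2) \<longlongrightarrow> (cmod (K z))\<^sup>2) (at z)"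
    unfolding isCont_def by (intro tendsto_intros)
  then have "((\<lambda>w. \<rho> ((cmod (K w))\<^sup>2)) \<longlongrightarrow> 1) (at z)"
    using filterlim_compose[OF minus_ln_one_minus_over_tendsto, of "\<lambda>w. (cmod (K w))\<^sup>2" "at z"] \<open>K z = 0\<close>
    unfolding \<rho>_def by simp
  from tendsto_mult[OF lim1 this]
  have "((\<lambda>w. (cmod (K w / (w - z)))\<^sup>2 * \<rho> ((cmod (K w))\<^sup>2)) \<longlongrightarrow> (cmod (deriv F z / m z))\<^sup>2) (at z)"
    by simp
  moreover have "(cmod (K w / (w - z)))\<^sup>2 * \<rho> ((cmod (K w))\<^sup>2) = v w / (cmod (w - z))\<^sup>2" for w
    by (simp add: \<rho>_def v_def norm_divide power_divide)
  ultimately have "((\<lambda>w. v w / (cmod (w - z))\<^sup>2) \<longlongrightarrow> (cmod (deriv F z / m z))\<^sup>2) (at z)"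
    by simp
  from lower_laplacian_harmonic_plus_quadratic[OF e(1) g(1) vc _ this dens]
  have "lower_laplacian (\<lambda>w. ln (liouville_density F w)) z = ereal (4 * (cmod (deriv F z / m z))\<^sup>2)"
    using \<open>K z = 0\<close> by (simp add: v_def)
  also have "4 * (cmod (deriv F z / m z))\<^sup>2 = (liouville_density F z)\<^sup>2"
    unfolding mz liouville_density_def c_def[symmetric]
    using sq1 by (simp add: norm_divide power_divide power_mult_distrib del: of_real_diff of_real_power)
  finally show ?thesis .
qed

section \<open>The Schwarz problem on the unit disc\<close>

text \<open>
  A Borel-Caratheodory estimate: \<open>G \<mapsto> G / (2 A - G)\<close> maps the half plane \<open>Re G < A\<close> into the unit disc
  and fixes \<open>0\<close>, so Schwarz's lemma applies. Here \<open>A\<close> is any number above \<open>2 \<delta>\<close>, which bounds the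
  oscillation of \<open>Re g\<close>.
\<close>

lemma norm_deriv_le_Re_bound:
  assumes \<rho>: "\<rho> > 0" and g: "g holomorphic_on ball z \<rho>"
    and Re: "\<And>w. w \<in> ball z \<rho> \<Longrightarrow> \<bar>Re (g w)\<bar> \<le> \<delta>"
  shows "cmod (deriv g z) \<le> 4 * \<delta> / \<rho>"
proof -
  have \<delta>: "\<delta> \<ge> 0" using Re[of z] \<rho> by force
  have bound: "cmod (deriv g z) * \<rho> / 2 \<le> A" if A: "A > 2 * \<delta>" for A
  proof -
    have Apos: "A > 0" using A \<delta> by linarith
    define G where "G w = g (z + of_real \<rho> * w) - g z" for w
    have inb: "z + of_real \<rho> * w \<in> ball z \<rho>" if "w \<in> ball 0 1" for w
      using that \<rho> by (simp add: dist_norm norm_mult)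
    have ReG: "Re (G w) < A" if "w \<in> ball 0 1" for w
      using Re[OF inb[OF that]] Re[of z] \<rho> A by (auto simp: G_def)
    have Gh: "G holomorphic_on ball 0 1"
      unfolding G_def using inb
      by (intro holomorphic_intros holomorphic_on_compose_gen[OF _ g, unfolded o_def]) auto
    define h where "h w = G w / (2 * of_real A - G w)" for w
    have nz: "2 * of_real A - G w \<noteq> 0" if "w \<in> ball 0 1" for w
    proof
      assume "2 * of_real A - G w = 0"
      then have "Re (2 * of_real A - G w) = 0" by simp
      then show False using ReG[OF that] Apos by simp
    qed
    have hh: "h holomorphic_on ball 0 1"
      unfolding h_def using nz by (intro holomorphic_intros Gh) auto
    have h0: "h 0 = 0" by (simp add: h_def G_def)
    have h1: "cmod (h w) < 1" if "cmod w < 1" for w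
    proof -
      have w: "w \<in> ball 0 1" using that by simp
      have "(cmod (2 * of_real A - G w))\<^sup>2 - (cmod (G w))\<^sup>2 = 4 * A * (A - Re (G w))"
        unfolding cmod_power2 by (simp add: power2_eq_square algebra_simps)
      also have "\<dots> > 0" using Apos ReG[OF w] by simp
      finally have "cmod (G w) < cmod (2 * of_real A - G w)"
        by (simp add: power_less_imp_less_base)
      then show ?thesis
        using nz[OF w] by (simp add: h_def norm_divide)
    qed
    have dg: "(g has_field_derivative deriv g z) (at z)"
      using g \<rho> by (auto intro: holomorphic_derivI)
    have dl: "((\<lambda>w. z + of_real \<rho> * w) has_field_derivative of_real \<rho>) (at 0)"
      by (auto intro!: derivative_eq_intros)
    have "((\<lambda>w. g (z + of_real \<rho> * w)) has_field_derivative deriv g z * of_real \<rho>) (at 0)"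
      by (rule DERIV_chain2[OF _ dl]) (use dg in simp)
    then have dG: "(G has_field_derivative deriv g z * of_real \<rho>) (at 0)"
      unfolding G_def by (auto intro!: derivative_eq_intros)
    moreover have "((\<lambda>w. 2 * of_real A - G w) has_field_derivative - (deriv g z * of_real \<rho>)) (at 0)"
      by (auto intro!: derivative_eq_intros dG)
    moreover have "2 * complex_of_real A - G 0 \<noteq> 0"
      using nz by simp
    ultimately have "(h has_field_derivative
       (deriv g z * of_real \<rho> * (2 * of_real A - G 0) - G 0 * - (deriv g z * of_real \<rho>)) /
       ((2 * of_real A - G 0) * (2 * of_real A - G 0))) (at 0)"
      unfolding h_def by (rule DERIV_divide)
    then have "(h has_field_derivative deriv g z * of_real \<rho> / (2 * of_real A)) (at 0)"
      using Apos by (simp add: G_def mult.commute)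
    then have "deriv h 0 = deriv g z * of_real \<rho> / (2 * of_real A)"
      by (rule DERIV_imp_deriv)
    moreover have "cmod (deriv h 0) \<le> 1"
      by (rule Schwarz_Lemma(2)[OF hh h0 h1, of 0]) auto
    ultimately have "cmod (deriv g z) * \<rho> / (2 * A) \<le> 1"
      using Apos \<rho> by (simp add: norm_divide norm_mult)
    then show ?thesis
      using Apos by (simp add: field_simps)
  qed
  then have "cmod (deriv g z) * \<rho> / 2 \<le> 2 * \<delta>"
    by (rule dense_ge)
  then show ?thesis
    using \<rho> by (simp add: field_simps)
qed

lemma radial_growth_bound:
  assumes H: "H holomorphic_on ball 0 1"
    and \<kappa>: "\<And>s. 0 \<le> s \<Longrightarrow> s < 1 \<Longrightarrow> (\<kappa> has_real_derivative \<kappa>' s) (at s)"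
    and le: "\<And>w. w \<in> ball 0 1 \<Longrightarrow> cmod (deriv H w) \<le> \<kappa>' (cmod w)"
    and z: "z \<in> ball 0 1"
  shows "cmod (H z - H 0) \<le> \<kappa> (cmod z) - \<kappa> 0"
proof -
  have in1: "t * cmod z < 1" "of_real t * z \<in> ball 0 1" if "0 \<le> t" "t \<le> 1" for t
  proof -
    have "t * cmod z \<le> 1 * cmod z" using that by (intro mult_right_mono) auto
    then show "t * cmod z < 1" using z by simp
    then show "of_real t * z \<in> ball 0 1" using that by (simp add: norm_mult)
  qed
  have df: "((\<lambda>t. H (of_real t * z)) has_vector_derivative z * deriv H (of_real t * z)) (at t)"
    if "0 \<le> t" "t \<le> 1" for t
  proof -
    have "((\<lambda>t. of_real t * z) has_vector_derivative z) (at t)"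
      by (auto intro!: derivative_eq_intros)
    moreover have "(H has_field_derivative deriv H (of_real t * z)) (at (of_real t * z))"
      using H in1(2)[OF that] by (auto intro: holomorphic_derivI)
    ultimately show ?thesis
      using field_vector_diff_chain_at[of "\<lambda>t. of_real t * z" z t H] by (simp add: o_def)
  qed
  have dk: "((\<lambda>t. \<kappa> (t * cmod z)) has_vector_derivative \<kappa>' (t * cmod z) * cmod z) (at t)"
    if "0 \<le> t" "t \<le> 1" for t
    unfolding has_real_derivative_iff_has_vector_derivative[symmetric]
    by (rule DERIV_chain2[of \<kappa>]) (use \<kappa> in1(1)[OF that] that in \<open>auto intro!: derivative_eq_intros\<close>)
  have "cmod (H (of_real 1 * z) - H (of_real 0 * z)) \<le> \<kappa> (1 * cmod z) - \<kappa> (0 * cmod z)"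
  proof (rule differentiable_bound_general[OF zero_less_one])
    show "continuous_on {0..1} (\<lambda>t. H (of_real t * z))"
      by (rule continuous_at_imp_continuous_on) (use df has_vector_derivative_continuous in force)
    show "continuous_on {0..1} (\<lambda>t. \<kappa> (t * cmod z))"
      by (rule continuous_at_imp_continuous_on) (use dk has_vector_derivative_continuous in force)
    show "cmod (z * deriv H (of_real t * z)) \<le> \<kappa>' (t * cmod z) * cmod z" if "0 < t" "t < 1" for t
    proof -
      have "cmod (deriv H (of_real t * z)) \<le> \<kappa>' (t * cmod z)"
        using le[OF in1(2), of t] that by (simp add: norm_mult)
      then have "cmod z * cmod (deriv H (of_real t * z)) \<le> cmod z * \<kappa>' (t * cmod z)"
        by (intro mult_left_mono) auto
      then show ?thesis
        by (simp add: norm_mult mult.commute)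
    qed
  qed (use df dk in auto)
  then show ?thesis by simp
qed

text \<open>
  The conjugate function of a bounded harmonic function may be unbounded, but it grows at most
  logarithmically. The logarithmic rate, as opposed to \<open>1 / (1 - |z|)\<close>, is what makes the bound
  integrable along radii.
\<close>

lemma norm_le_log_of_Re_bound:
  assumes g: "g holomorphic_on ball 0 1" and Re: "\<And>w. w \<in> ball 0 1 \<Longrightarrow> \<bar>Re (g w)\<bar> \<le> \<delta>"
    and Im: "Im (g 0) = 0" and z: "z \<in> ball 0 1"
  shows "cmod (g z) \<le> \<delta> * (1 - 4 * ln (1 - cmod z))"
proof -
  have "cmod (g z - g 0) \<le> - 4 * \<delta> * ln (1 - cmod z) - (- 4 * \<delta> * ln (1 - 0))"
  proof (rule radial_growth_bound[OF g _ _ z, where \<kappa> = "\<lambda>s. - 4 * \<delta> * ln (1 - s)"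
        and \<kappa>' = "\<lambda>s. 4 * \<delta> / (1 - s)"])
    show "((\<lambda>s. - 4 * \<delta> * ln (1 - s)) has_real_derivative 4 * \<delta> / (1 - s)) (at s)" if "s < 1" for s
      using that by (auto intro!: derivative_eq_intros simp: field_simps)
    show "cmod (deriv g w) \<le> 4 * \<delta> / (1 - cmod w)" if "w \<in> ball 0 1" for w
    proof -
      have sub: "ball w (1 - cmod w) \<subseteq> ball 0 1"
      proof
        fix x assume "x \<in> ball w (1 - cmod w)"
        then show "x \<in> ball 0 1"
          using norm_triangle_sub[of x w] by (simp add: dist_norm norm_minus_commute)
      qed
      then show ?thesis
        using that Re by (intro norm_deriv_le_Re_bound holomorphic_on_subset[OF g]) auto
    qed
  qed
  moreover have "cmod (g 0) \<le> \<delta>"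
    using Re[of 0] Im by (simp add: cmod_def)
  ultimately show ?thesis
    using norm_triangle_sub[of "g z" "g 0"] by (simp add: algebra_simps)
qed

text \<open>
  Integrating a logarithmic singularity along radii: \<open>5 s + 4 (1 - s) ln (1 - s)\<close> is a primitive of
  \<open>1 - 4 ln (1 - s)\<close>, and it is at most \<open>5\<close> on the unit interval.
\<close>

lemma norm_le_of_log_deriv_bound:
  assumes H: "H holomorphic_on ball 0 1" and H0: "H 0 = 0" and M: "M \<ge> 0"
    and le: "\<And>w. w \<in> ball 0 1 \<Longrightarrow> cmod (deriv H w) \<le> M * (1 - 4 * ln (1 - cmod w))"
    and z: "z \<in> ball 0 1"
  shows "cmod (H z) \<le> 5 * M"
proof -
  define k where "k s = M * (5 * s + 4 * (1 - s) * ln (1 - s))" for s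
  have "cmod (H z - H 0) \<le> k (cmod z) - k 0"
  proof (rule radial_growth_bound[OF H _ _ z, where \<kappa>' = "\<lambda>s. M * (1 - 4 * ln (1 - s))"])
    show "(k has_real_derivative M * (1 - 4 * ln (1 - s))) (at s)" if "s < 1" for s
    proof -
      have "((\<lambda>s. (1 - s) * ln (1 - s)) has_real_derivative - ln (1 - s) - 1) (at s)"
        using that by (auto intro!: derivative_eq_intros)
      from DERIV_cmult[OF DERIV_add[OF DERIV_cmult[OF DERIV_ident, of 5] DERIV_cmult[OF this, of 4]], of M]
      show ?thesis by (simp add: k_def[abs_def] algebra_simps)
    qed
  qed (rule le)
  also have "\<dots> \<le> 5 * M"
  proof -
    have "(1 - cmod z) * ln (1 - cmod z) \<le> 0"
      using z by (simp add: mult_le_0_iff)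
    then have "5 * cmod z + 4 * (1 - cmod z) * ln (1 - cmod z) \<le> 5"
      unfolding mult.assoc using z by (simp only: mem_ball_0)
    then have "M * (5 * cmod z + 4 * (1 - cmod z) * ln (1 - cmod z)) \<le> M * 5"
      using M by (intro mult_left_mono)
    then show ?thesis by (simp add: k_def)
  qed
  finally show ?thesis by (simp add: H0)
qed

text \<open>
  The real part of \<open>g\<close> extends continuously to the closed disc, whereas \<open>g\<close> itself need not. The
  condition at \<open>0\<close> fixes the additive imaginary constant.
\<close>

definition schwarz_pair :: "(complex \<Rightarrow> complex) \<Rightarrow> (complex \<Rightarrow> real) \<Rightarrow> bool" where
  "schwarz_pair g u \<longleftrightarrow> g holomorphic_on ball 0 1 \<and> Im (g 0) = 0 \<and>
     continuous_on (cball 0 1) u \<and> (\<forall>z\<in>ball 0 1. Re (g z) = u z)"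

lemma schwarz_pair_diff:
  "schwarz_pair g1 u1 \<Longrightarrow> schwarz_pair g2 u2 \<Longrightarrow> schwarz_pair (\<lambda>z. g1 z - g2 z) (\<lambda>z. u1 z - u2 z)"
  unfolding schwarz_pair_def by (auto intro!: holomorphic_intros continuous_intros)

text \<open>
  If \<open>u\<close> had an interior maximum then \<open>exp \<circ> g\<close> would attain its maximum modulus there and be
  constant, so \<open>u\<close> would be constant on the closed disc.
\<close>

lemma schwarz_pair_max:
  assumes pair: "schwarz_pair g u" and B: "\<And>z. z \<in> sphere 0 1 \<Longrightarrow> u z \<le> B" and z: "z \<in> cball 0 1"
  shows "u z \<le> B"
proof -
  have g: "g holomorphic_on ball 0 1" and u: "continuous_on (cball 0 1) u"
    and gu: "\<And>z. z \<in> ball 0 1 \<Longrightarrow> Re (g z) = u z"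
    using pair by (auto simp: schwarz_pair_def)
  obtain \<xi> where \<xi>: "\<xi> \<in> cball 0 1" "\<And>y. y \<in> cball 0 1 \<Longrightarrow> u y \<le> u \<xi>"
    using continuous_attains_sup[OF _ _ u] by auto
  have "u \<xi> \<le> B"
  proof (cases "\<xi> \<in> sphere 0 1")
    case False
    then have \<xi>': "\<xi> \<in> ball 0 1" using \<xi>(1) by auto
    have "(\<lambda>z. exp (g z)) constant_on ball 0 1"
      by (rule maximum_modulus_principle[where U = "ball 0 1" and \<xi> = \<xi>])
        (use \<xi> \<xi>' g gu in \<open>auto intro!: holomorphic_intros\<close>)
    then obtain c where c: "\<And>z. z \<in> ball 0 1 \<Longrightarrow> exp (g z) = c"
      by (auto simp: constant_on_def)
    have const: "u y = u \<xi>" if "y \<in> ball 0 1" for y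
    proof -
      have "cmod (exp (g y)) = cmod (exp (g \<xi>))" using c \<xi>' that by simp
      then show ?thesis using gu \<xi>' that by simp
    qed
    have cl: "closure (ball (0::complex) 1) = cball 0 1"
      by simp
    have "continuous_on (closure (ball 0 1)) u"
      unfolding cl by (rule u)
    then have "u 1 = u \<xi>"
      using const by (rule continuous_constant_on_closure) (simp_all add: cl)
    then show ?thesis using B[of 1] by simp
  qed (use B in auto)
  then show ?thesis using \<xi>(2)[OF z] by linarith
qed

lemma schwarz_pair_bound:
  assumes "schwarz_pair g1 u1" "schwarz_pair g2 u2"
    and le: "\<And>z. z \<in> sphere 0 1 \<Longrightarrow> \<bar>u1 z - u2 z\<bar> \<le> \<delta>"
  shows "\<And>z. z \<in> cball 0 1 \<Longrightarrow> \<bar>u1 z - u2 z\<bar> \<le> \<delta>"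
    and "\<And>z. z \<in> ball 0 1 \<Longrightarrow> cmod (g1 z - g2 z) \<le> \<delta> * (1 - 4 * ln (1 - cmod z))"
proof -
  have d: "schwarz_pair (\<lambda>z. g1 z - g2 z) (\<lambda>z. u1 z - u2 z)" "schwarz_pair (\<lambda>z. g2 z - g1 z) (\<lambda>z. u2 z - u1 z)"
    using assms by (auto intro: schwarz_pair_diff)
  show *: "\<bar>u1 z - u2 z\<bar> \<le> \<delta>" if "z \<in> cball 0 1" for z
    using schwarz_pair_max[OF d(1) _ that, of \<delta>] schwarz_pair_max[OF d(2) _ that, of \<delta>] le
    by (smt (verit))
  show "cmod (g1 z - g2 z) \<le> \<delta> * (1 - 4 * ln (1 - cmod z))" if "z \<in> ball 0 1" for z
  proof (rule norm_le_log_of_Re_bound[where g = "\<lambda>z. g1 z - g2 z"])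
    show "\<bar>Re (g1 w - g2 w)\<bar> \<le> \<delta>" if "w \<in> ball 0 1" for w
      using *[of w] that d(1) by (auto simp: schwarz_pair_def)
  qed (use d(1) that in \<open>auto simp: schwarz_pair_def\<close>)
qed

text \<open>
  By the maximum principle the \<open>u n\<close> are uniformly Cauchy on the closed disc, and by the
  logarithmic bound the \<open>g n\<close> are so on smaller discs.
\<close>

lemma schwarz_pair_limit:
  assumes pair: "\<And>n. schwarz_pair (g n) (u n)" and C: "uniformly_Cauchy_on (sphere 0 1) u"
  shows "\<exists>g' u'. schwarz_pair g' u' \<and> uniform_limit (cball 0 1) u u' sequentially \<and>
    (\<forall>z\<in>ball 0 1. (\<lambda>n. g n z) \<longlonglongrightarrow> g' z)"
proof -
  have N: "\<exists>N. \<forall>m\<ge>N. \<forall>n\<ge>N. \<forall>z\<in>sphere 0 1. \<bar>u m z - u n z\<bar> \<le> e" if "e > 0" for e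
    using C that unfolding uniformly_Cauchy_on_def dist_real_def by (meson less_imp_le)
  have "uniformly_Cauchy_on (cball 0 1) u"
    unfolding uniformly_Cauchy_on_def
  proof safe
    fix e :: real assume "e > 0"
    then obtain N where N: "\<And>m n z. m \<ge> N \<Longrightarrow> n \<ge> N \<Longrightarrow> z \<in> sphere 0 1 \<Longrightarrow> \<bar>u m z - u n z\<bar> \<le> e / 2"
      using N[OF half_gt_zero[OF \<open>e > 0\<close>]] by blast
    have "dist (u m x) (u n x) < e" if "x \<in> cball 0 1" "m \<ge> N" "n \<ge> N" for x m n
      using schwarz_pair_bound(1)[OF pair pair N, of m n x] that \<open>e > 0\<close> by (auto simp: dist_real_def)
    then show "\<exists>M. \<forall>x\<in>cball 0 1. \<forall>m\<ge>M. \<forall>n\<ge>M. dist (u m x) (u n x) < e" by blast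
  qed
  then obtain u' where u': "uniform_limit (cball 0 1) u u' sequentially"
    using Cauchy_uniformly_convergent uniformly_convergent_on_def by metis
  have u'c: "continuous_on (cball 0 1) u'"
    by (rule uniform_limit_theorem[OF _ u']) (use pair in \<open>auto simp: schwarz_pair_def\<close>)
  define g' where "g' z = lim (\<lambda>n. g n z)" for z
  have ul: "uniform_limit (cball 0 r) g g' sequentially" if r: "0 \<le> r" "r < 1" for r
  proof -
    have "uniformly_Cauchy_on (cball 0 r) g"
      unfolding uniformly_Cauchy_on_def
    proof safe
      fix e :: real assume "e > 0"
      define k where "k = 1 - 4 * ln (1 - r)"
      have "ln (1 - r) \<le> 0" using r by simp
      then have k: "k > 0" by (simp add: k_def)
      then have "e / (2 * k) > 0" using \<open>e > 0\<close> by simp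
      then obtain N where N: "\<And>m n z. m \<ge> N \<Longrightarrow> n \<ge> N \<Longrightarrow> z \<in> sphere 0 1 \<Longrightarrow> \<bar>u m z - u n z\<bar> \<le> e / (2 * k)"
        using N by blast
      have "dist (g m x) (g n x) < e" if "x \<in> cball 0 r" "m \<ge> N" "n \<ge> N" for x m n
      proof -
        have x: "cmod x \<le> r" "cmod x < 1" using that r by auto
        have "dist (g m x) (g n x) \<le> e / (2 * k) * (1 - 4 * ln (1 - cmod x))"
          using schwarz_pair_bound(2)[OF pair pair N, of m n x] that x by (auto simp: dist_norm)
        also have "\<dots> \<le> e / (2 * k) * k"
          unfolding k_def[symmetric] using x r k \<open>e > 0\<close> by (intro mult_left_mono) (auto simp: k_def)
        also have "\<dots> < e" using k \<open>e > 0\<close> by simp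
        finally show ?thesis .
      qed
      then show "\<exists>M. \<forall>x\<in>cball 0 r. \<forall>m\<ge>M. \<forall>n\<ge>M. dist (g m x) (g n x) < e" by blast
    qed
    then have "uniformly_convergent_on (cball 0 r) g"
      by (rule Cauchy_uniformly_convergent)
    then show ?thesis
      unfolding uniformly_convergent_uniform_limit_iff g'_def .
  qed
  have lim: "(\<lambda>n. g n z) \<longlonglongrightarrow> g' z" if "z \<in> ball 0 1" for z
    using ul[of "cmod z"] that by (auto intro: tendsto_uniform_limitI)
  have "g' holomorphic_on ball 0 1"
  proof (rule holomorphic_uniform_sequence)
    show "\<exists>d>0. cball x d \<subseteq> ball 0 1 \<and> uniform_limit (cball x d) g g' sequentially" if "x \<in> ball 0 1" for x
    proof -
      define d where "d = (1 - cmod x) / 2"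
      have d: "d > 0" "cmod x + d < 1" using that by (auto simp: d_def field_simps)
      have sub: "cball x d \<subseteq> cball 0 (cmod x + d)"
      proof
        fix y assume "y \<in> cball x d"
        then show "y \<in> cball 0 (cmod x + d)"
          using norm_triangle_sub[of y x] by (simp add: dist_norm norm_minus_commute)
      qed
      also have "\<dots> \<subseteq> ball 0 1" using d by auto
      finally have "cball x d \<subseteq> ball 0 1" .
      moreover have "uniform_limit (cball x d) g g' sequentially"
        using ul[of "cmod x + d"] d by (intro uniform_limit_on_subset[OF _ sub]) auto
      ultimately show ?thesis using d by blast
    qed
  qed (use pair in \<open>auto simp: schwarz_pair_def\<close>)
  moreover have "Im (g' 0) = 0"
  proof -
    have "(\<lambda>n. Im (g n 0)) \<longlonglongrightarrow> Im (g' 0)"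
      using lim[of 0] by (intro tendsto_Im) simp
    moreover have "(\<lambda>n. Im (g n 0)) = (\<lambda>n. 0)"
      using pair by (simp add: schwarz_pair_def)
    ultimately show ?thesis
      using LIMSEQ_unique[OF _ tendsto_const] by metis
  qed
  moreover have "Re (g' z) = u' z" if "z \<in> ball 0 1" for z
  proof -
    have "(\<lambda>n. Re (g n z)) \<longlonglongrightarrow> Re (g' z)" by (intro tendsto_Re lim that)
    moreover have "(\<lambda>n. Re (g n z)) = (\<lambda>n. u n z)"
      using pair that by (simp add: schwarz_pair_def)
    moreover have "(\<lambda>n. u n z) \<longlonglongrightarrow> u' z"
      using u' that by (auto intro: tendsto_uniform_limitI)
    ultimately show ?thesis
      using LIMSEQ_unique by metis
  qed
  ultimately have "schwarz_pair g' u'"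
    using u'c by (auto simp: schwarz_pair_def)
  then show ?thesis using u' lim by blast
qed

text \<open>
  The real parts of complex polynomials; on the unit circle these are the real trigonometric
  polynomials.
\<close>

inductive trig_polynomial :: "(complex \<Rightarrow> real) \<Rightarrow> bool" where
  monomial: "trig_polynomial (\<lambda>z. Re (a * z ^ n))"
| add: "trig_polynomial f \<Longrightarrow> trig_polynomial h \<Longrightarrow> trig_polynomial (\<lambda>z. f z + h z)"

lemma trig_polynomial_schwarz_pair:
  assumes "trig_polynomial f" obtains g where "schwarz_pair g f"
proof -
  from assms have "\<exists>P. P holomorphic_on UNIV \<and> (\<forall>z. f z = Re (P z))"
  proof induction
    case (monomial a n)
    show ?case by (intro exI[of _ "\<lambda>z. a * z ^ n"]) (auto intro!: holomorphic_intros)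
  next
    case (add f h)
    then obtain P Q where "P holomorphic_on UNIV" "Q holomorphic_on UNIV"
      "\<forall>z. f z = Re (P z)" "\<forall>z. h z = Re (Q z)" by blast
    then show ?case by (intro exI[of _ "\<lambda>z. P z + Q z"]) (auto intro!: holomorphic_intros)
  qed
  then obtain P where P: "P holomorphic_on UNIV" "\<And>z. f z = Re (P z)" by blast
  have "f = (\<lambda>z. Re (P z))" using P(2) by blast
  then have "schwarz_pair (\<lambda>z. P z - \<i> * of_real (Im (P 0))) f"
    using holomorphic_on_subset[OF P(1), of "ball 0 1"]
      holomorphic_on_imp_continuous_on[OF holomorphic_on_subset[OF P(1), of "cball 0 1"]]
    by (auto simp: schwarz_pair_def intro!: holomorphic_intros continuous_intros)
  then show thesis by (rule that)
qed

text \<open>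
  On the circle \<open>cnj z = 1 / z\<close>, so the mixed term of \<open>Re x * Re y = (Re (x * y) + Re (x * cnj y)) / 2\<close>
  is again the real part of a monomial, after conjugation if its exponent is negative.
\<close>

lemma trig_polynomial_mult:
  assumes "trig_polynomial f" "trig_polynomial h"
  shows "\<exists>k. trig_polynomial k \<and> (\<forall>z\<in>sphere 0 1. k z = f z * h z)"
  using assms(1)
proof induction
  case (add f1 f2)
  then obtain k1 k2 where "trig_polynomial k1" "trig_polynomial k2"
    "\<forall>z\<in>sphere 0 1. k1 z = f1 z * h z" "\<forall>z\<in>sphere 0 1. k2 z = f2 z * h z" by blast
  then show ?case
    by (intro exI[of _ "\<lambda>z. k1 z + k2 z"]) (auto intro: trig_polynomial.add simp: algebra_simps)
next
  case (monomial a n)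
  from assms(2) show ?case
  proof induction
    case (add f1 f2)
    then obtain k1 k2 where "trig_polynomial k1" "trig_polynomial k2"
      "\<forall>z\<in>sphere 0 1. k1 z = Re (a * z ^ n) * f1 z" "\<forall>z\<in>sphere 0 1. k2 z = Re (a * z ^ n) * f2 z" by blast
    then show ?case
      by (intro exI[of _ "\<lambda>z. k1 z + k2 z"] conjI ballI trig_polynomial.add)
        (auto simp: distrib_left simp del: times_complex.sel)
  next
    case (monomial b m)
    have prod: "Re x * Re y = Re (x * y) / 2 + Re (x * cnj y) / 2" for x y :: complex
      by (simp add: field_simps)
    have half: "Re (x / 2 * y) = Re (x * y) / 2" for x y :: complex
      by (simp add: field_simps)
    have unit: "z ^ i * cnj z ^ i = 1" if "z \<in> sphere 0 1" for z :: complex and i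
    proof -
      have "z * cnj z = 1" using that complex_norm_square[of z] by simp
      then show ?thesis by (simp flip: power_mult_distrib)
    qed
    show ?case
    proof (cases "m \<le> n")
      case True
      have "a * z ^ n * cnj (b * z ^ m) = a * cnj b * z ^ (n - m)" if "z \<in> sphere 0 1" for z
      proof -
        have "a * z ^ n * cnj (b * z ^ m) = a * cnj b * z ^ (n - m) * (z ^ m * cnj z ^ m)"
          using True by (simp add: mult_ac flip: power_add)
        then show ?thesis using unit[OF that, of m] by simp
      qed
      moreover have "a * z ^ n * (b * z ^ m) = a * b * z ^ (n + m)" for z
        by (simp add: power_add)
      ultimately have "Re (a * b / 2 * z ^ (n + m)) + Re (a * cnj b / 2 * z ^ (n - m)) = Re (a * z ^ n) * Re (b * z ^ m)"
        if "z \<in> sphere 0 1" for z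
        using that by (simp only: prod half)
      then have "\<forall>z\<in>sphere 0 1. Re (a * b / 2 * z ^ (n + m)) + Re (a * cnj b / 2 * z ^ (n - m)) = Re (a * z ^ n) * Re (b * z ^ m)"
        by (rule ballI)
      then show ?thesis
        by (intro exI[of _ "\<lambda>z. Re (a * b / 2 * z ^ (n + m)) + Re (a * cnj b / 2 * z ^ (n - m))"] conjI trig_polynomial.intros)
    next
      case False
      have "cnj (a * z ^ n * cnj (b * z ^ m)) = cnj a * b * z ^ (m - n)" if "z \<in> sphere 0 1" for z
      proof -
        have "cnj (a * z ^ n * cnj (b * z ^ m)) = cnj a * b * z ^ (m - n) * (z ^ n * cnj z ^ n)"
          using False by (simp add: mult_ac flip: power_add)
        then show ?thesis using unit[OF that, of n] by simp
      qed
      then have "Re (a * z ^ n * cnj (b * z ^ m)) = Re (cnj a * b * z ^ (m - n))" if "z \<in> sphere 0 1" for z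
        using that by (metis complex_cnj_cnj cnj.sel(1))
      moreover have "a * z ^ n * (b * z ^ m) = a * b * z ^ (n + m)" for z
        by (simp add: power_add)
      ultimately have "Re (a * b / 2 * z ^ (n + m)) + Re (cnj a * b / 2 * z ^ (m - n)) = Re (a * z ^ n) * Re (b * z ^ m)"
        if "z \<in> sphere 0 1" for z
        using that by (simp only: prod half)
      then have "\<forall>z\<in>sphere 0 1. Re (a * b / 2 * z ^ (n + m)) + Re (cnj a * b / 2 * z ^ (m - n)) = Re (a * z ^ n) * Re (b * z ^ m)"
        by (rule ballI)
      then show ?thesis
        by (intro exI[of _ "\<lambda>z. Re (a * b / 2 * z ^ (n + m)) + Re (cnj a * b / 2 * z ^ (m - n))"] conjI trig_polynomial.intros)
    qed
  qed
qed

lemma real_polynomial_function_on_circle: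
  fixes p :: "complex \<Rightarrow> real"
  assumes "real_polynomial_function p"
  shows "\<exists>k. trig_polynomial k \<and> (\<forall>z\<in>sphere 0 1. k z = p z)"
  using assms
proof induction
  case (linear f)
  have f_eq: "f z = Re (Complex (f 1) (- f \<i>) * z ^ 1)" for z
  proof -
    interpret bounded_linear f by fact
    have "f z = f (Re z *\<^sub>R 1 + Im z *\<^sub>R \<i>)"
      by (rule arg_cong[where f = f]) (simp add: complex_eq_iff)
    then show ?thesis by (simp add: add scaleR mult.commute)
  qed
  show ?case
    by (intro exI conjI ballI, rule trig_polynomial.monomial, rule f_eq[symmetric])
next
  case (const c)
  show ?case
    using trig_polynomial.monomial[of "of_real c" 0] by (intro exI[of _ "\<lambda>z. c"]) simp
next
  case (add f h)
  then obtain k1 k2 where "trig_polynomial k1" "trig_polynomial k2"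
    "\<forall>z\<in>sphere 0 1. k1 z = f z" "\<forall>z\<in>sphere 0 1. k2 z = h z" by blast
  then show ?case by (intro exI[of _ "\<lambda>z. k1 z + k2 z"]) (auto intro: trig_polynomial.add)
next
  case (mult f h)
  then obtain k1 k2 where k: "trig_polynomial k1" "trig_polynomial k2"
    "\<forall>z\<in>sphere 0 1. k1 z = f z" "\<forall>z\<in>sphere 0 1. k2 z = h z" by blast
  obtain k where "trig_polynomial k" "\<forall>z\<in>sphere 0 1. k z = k1 z * k2 z"
    using trig_polynomial_mult[OF k(1,2)] by blast
  then show ?case using k by (intro exI[of _ k]) simp
qed

text \<open>
  For trigonometric polynomials the solution is explicit. They are dense by the Stone-Weierstrass
  theorem, and solutions depend continuously on the boundary values.
\<close>

lemma schwarz_problem: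
  assumes "continuous_on (sphere 0 1) \<psi>"
  shows "\<exists>g u. schwarz_pair g u \<and> (\<forall>z\<in>sphere 0 1. u z = \<psi> z)"
proof -
  have "\<exists>k. trig_polynomial k \<and> (\<forall>z\<in>sphere 0 1. \<bar>\<psi> z - k z\<bar> < inverse (real (Suc n)))" for n
  proof -
    obtain p where "real_polynomial_function p" "\<And>x. x \<in> sphere 0 1 \<Longrightarrow> \<bar>\<psi> x - p x\<bar> < inverse (real (Suc n))"
      using Stone_Weierstrass_real_polynomial_function[OF _ assms, of "inverse (real (Suc n))"]
      by (metis compact_sphere inverse_positive_iff_positive of_nat_0_less_iff zero_less_Suc)
    moreover from this obtain k where "trig_polynomial k" "\<forall>z\<in>sphere 0 1. k z = p z"
      using real_polynomial_function_on_circle by blast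
    ultimately show ?thesis by (intro exI[of _ k]) simp
  qed
  then obtain k where k: "\<And>n. trig_polynomial (k n)"
    "\<And>n z. z \<in> sphere 0 1 \<Longrightarrow> \<bar>\<psi> z - k n z\<bar> < inverse (real (Suc n))" by metis
  have "\<forall>n. \<exists>g. schwarz_pair g (k n)"
    using trig_polynomial_schwarz_pair[OF k(1)] by blast
  then obtain g where g: "\<And>n. schwarz_pair (g n) (k n)" by metis
  have ul: "uniform_limit (sphere 0 1) k \<psi> sequentially"
    unfolding uniform_limit_iff
  proof (intro allI impI)
    fix e :: real assume "e > 0"
    then have "\<forall>\<^sub>F n in sequentially. inverse (real (Suc n)) < e"
      by (rule order_tendstoD(2)[OF LIMSEQ_inverse_real_of_nat])
    then show "\<forall>\<^sub>F n in sequentially. \<forall>x\<in>sphere 0 1. dist (k n x) (\<psi> x) < e"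
    proof eventually_elim
      case (elim n)
      show ?case
      proof
        fix x :: complex assume x: "x \<in> sphere 0 1"
        have "dist (k n x) (\<psi> x) = \<bar>\<psi> x - k n x\<bar>"
          by (simp add: dist_real_def abs_minus_commute)
        then show "dist (k n x) (\<psi> x) < e"
          using k(2)[OF x, of n] elim by linarith
      qed
    qed
  qed
  then have "uniformly_Cauchy_on (sphere 0 1) k"
    by (intro uniformly_convergent_Cauchy uniformly_convergentI)
  then obtain g' u' where *: "schwarz_pair g' u'" "uniform_limit (cball 0 1) k u' sequentially"
    using schwarz_pair_limit[of g k, OF g] by blast
  have "u' z = \<psi> z" if "z \<in> sphere 0 1" for z
    using tendsto_uniform_limitI[OF *(2), of z] tendsto_uniform_limitI[OF ul that] that
    by (auto intro: LIMSEQ_unique)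
  then show ?thesis using * by blast
qed

section \<open>Prescribing boundary values of metrics of curvature minus one\<close>

lemma ln_one_minus_norm_sq_lipschitz:
  fixes a b :: complex
  assumes "cmod a \<le> 1/2" "cmod b \<le> 1/2"
  shows "\<bar>ln (1 - (cmod a)\<^sup>2) - ln (1 - (cmod b)\<^sup>2)\<bar> \<le> 4/3 * cmod (a - b)"
proof -
  have half: "ln (1 - (cmod a)\<^sup>2) - ln (1 - (cmod b)\<^sup>2) \<le> 4/3 * cmod (a - b)"
    if a: "cmod a \<le> 1/2" and b: "cmod b \<le> 1/2" for a b :: complex
  proof -
    have X: "1 - (cmod a)\<^sup>2 \<ge> 3/4" by (rule half_disc_gap[OF a])
    have Y: "1 - (cmod b)\<^sup>2 \<ge> 3/4" by (rule half_disc_gap[OF b])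
    have "ln (1 - (cmod a)\<^sup>2) - ln (1 - (cmod b)\<^sup>2) = ln ((1 - (cmod a)\<^sup>2) / (1 - (cmod b)\<^sup>2))"
      using X Y by (simp add: ln_div)
    also have "\<dots> \<le> (1 - (cmod a)\<^sup>2) / (1 - (cmod b)\<^sup>2) - 1"
      using X Y by (intro ln_le_minus_one) auto
    also have "\<dots> = ((cmod b)\<^sup>2 - (cmod a)\<^sup>2) / (1 - (cmod b)\<^sup>2)"
      using Y by (simp add: field_simps)
    also have "(cmod b)\<^sup>2 - (cmod a)\<^sup>2 = (cmod b + cmod a) * (cmod b - cmod a)"
      by (simp add: power2_eq_square algebra_simps)
    also have "\<dots> / (1 - (cmod b)\<^sup>2) \<le> cmod (a - b) / (3/4)"
    proof (rule frac_le)
      have "(cmod b + cmod a) * (cmod b - cmod a) \<le> (cmod b + cmod a) * cmod (a - b)"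
        using norm_triangle_ineq2[of b a] by (intro mult_left_mono) (auto simp: norm_minus_commute)
      also have "\<dots> \<le> 1 * cmod (a - b)"
        using a b by (intro mult_right_mono) auto
      finally show "(cmod b + cmod a) * (cmod b - cmod a) \<le> cmod (a - b)" by simp
    qed (use Y in auto)
    finally show ?thesis by simp
  qed
  show ?thesis
    using half[OF assms] half[OF assms(2,1)] norm_minus_commute[of a b] by linarith
qed

lemma norm_exp_diff_le:
  fixes a b :: complex
  assumes "exp (Re a) \<le> M" "exp (Re b) \<le> M"
  shows "cmod (exp a - exp b) \<le> M * cmod (a - b)"
proof -
  have M: "M > 0" using assms(1) by (meson exp_gt_zero less_le_trans)
  have le: "Re c \<le> ln M \<longleftrightarrow> exp (Re c) \<le> M" for c
    using M by (metis exp_le_cancel_iff exp_ln)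
  show ?thesis
  proof (rule field_differentiable_bound[where S = "{z. Re z \<le> ln M}" and f' = exp])
    show "convex {z. Re z \<le> ln M}" by (rule convex_halfspace_Re_le)
  qed (use le assms in \<open>auto intro!: derivative_eq_intros\<close>)
qed

text \<open>
  \<open>G\<close> is the image of \<open>F\<close> under the fixed-point operator, with \<open>g\<close> and \<open>u\<close> as witnesses. For a
  fixed point \<open>F = G\<close> the equation on the circle says that the Liouville density of \<open>F\<close> has boundary
  values \<open>2 exp \<psi>\<close>.
\<close>

definition riemann_hilbert_step ::
    "(complex \<Rightarrow> real) \<Rightarrow> (complex \<Rightarrow> complex) \<Rightarrow> (complex \<Rightarrow> complex) \<Rightarrow>
     (complex \<Rightarrow> complex) \<Rightarrow> (complex \<Rightarrow> real) \<Rightarrow> bool" where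
  "riemann_hilbert_step \<psi> F G g u \<longleftrightarrow>
     schwarz_pair g u \<and> (\<forall>z\<in>sphere 0 1. u z = \<psi> z + ln (1 - (cmod (F z))\<^sup>2)) \<and>
     continuous_on (cball 0 1) G \<and> G 0 = 0 \<and>
     (\<forall>z\<in>ball 0 1. (G has_field_derivative exp (g z)) (at z))"

text \<open>
  The domain of the fixed-point operator. On the disc of radius \<open>1/2\<close> the function \<open>ln (1 - |z|^2)\<close> is Lipschitz with
  constant \<open>4/3\<close>.
\<close>

definition half_disc_map :: "(complex \<Rightarrow> complex) \<Rightarrow> bool" where
  "half_disc_map F \<longleftrightarrow> continuous_on (cball 0 1) F \<and> (\<forall>z\<in>cball 0 1. cmod (F z) \<le> 1/2)"

lemma riemann_hilbert_step_exp_bound: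
  assumes \<psi>: "\<And>z. z \<in> sphere 0 1 \<Longrightarrow> exp (\<psi> z) \<le> 1/16" and F: "half_disc_map F"
    and pair: "schwarz_pair g u"
    and u: "\<And>z. z \<in> sphere 0 1 \<Longrightarrow> u z = \<psi> z + ln (1 - (cmod (F z))\<^sup>2)"
    and z: "z \<in> ball 0 1"
  shows "exp (Re (g z)) \<le> 1/16"
proof -
  have "u z \<le> ln (1/16)"
  proof (rule schwarz_pair_max[OF pair])
    fix w :: complex assume w: "w \<in> sphere 0 1"
    have "cmod (F w) \<le> 1/2" using F w by (auto simp: half_disc_map_def)
    then have "3/4 \<le> 1 - (cmod (F w))\<^sup>2" by (rule half_disc_gap)
    then have "ln (1 - (cmod (F w))\<^sup>2) \<le> 0" by simp
    moreover have "\<psi> w \<le> ln (1/16)" using \<psi>[OF w] by (metis exp_gt_zero ln_exp ln_mono)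
    ultimately show "u w \<le> ln (1/16)" using u[OF w] by linarith
  qed (use z in auto)
  then have "exp (u z) \<le> exp (ln (1/16))" by (simp only: exp_le_cancel_iff)
  then show ?thesis using pair z by (simp add: schwarz_pair_def)
qed

lemma riemann_hilbert_step_exists:
  assumes \<psi>c: "continuous_on (sphere 0 1) \<psi>" and \<psi>: "\<And>z. z \<in> sphere 0 1 \<Longrightarrow> exp (\<psi> z) \<le> 1/16"
    and F: "half_disc_map F"
  shows "\<exists>G g u. riemann_hilbert_step \<psi> F G g u \<and> half_disc_map G"
proof -
  have Fc: "continuous_on (sphere 0 1) F"
    using F by (auto simp: half_disc_map_def intro: continuous_on_subset)
  have nz: "1 - (cmod (F z))\<^sup>2 \<noteq> 0" if "z \<in> sphere 0 1" for z
  proof -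
    have "cmod (F z) \<le> 1/2" using F that by (auto simp: half_disc_map_def)
    then have "3/4 \<le> 1 - (cmod (F z))\<^sup>2" by (rule half_disc_gap)
    then show ?thesis by simp
  qed
  have "continuous_on (sphere 0 1) (\<lambda>z. \<psi> z + ln (1 - (cmod (F z))\<^sup>2))"
    using nz by (intro continuous_intros \<psi>c Fc) auto
  then obtain g u where pair: "schwarz_pair g u"
    and u: "\<And>z. z \<in> sphere 0 1 \<Longrightarrow> u z = \<psi> z + ln (1 - (cmod (F z))\<^sup>2)"
    using schwarz_problem by blast
  have "(\<lambda>z. exp (g z)) holomorphic_on ball 0 1"
    using pair by (auto simp: schwarz_pair_def intro!: holomorphic_intros)
  then obtain P where P: "\<And>z. z \<in> ball 0 1 \<Longrightarrow> (P has_field_derivative exp (g z)) (at z within ball 0 1)"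
    using holomorphic_convex_primitive'[OF convex_ball open_ball] by metis
  have bnd: "cmod (exp (g z)) \<le> 1/16" if "z \<in> ball 0 1" for z
    using riemann_hilbert_step_exp_bound[OF \<psi> F pair u that] by simp
  have lip: "cmod (P x - P y) \<le> 1/16 * cmod (x - y)" if "x \<in> ball 0 1" "y \<in> ball 0 1" for x y
    by (rule field_differentiable_bound[OF convex_ball P bnd]) (use that in auto)
  have "(1/16)-lipschitz_on (ball 0 1) P"
    using lip by (auto simp: lipschitz_on_def dist_norm)
  then have "uniformly_continuous_on (ball 0 1) P"
    by (rule lipschitz_on_uniformly_continuous)
  then obtain Q where Q: "uniformly_continuous_on (closure (ball 0 1)) Q" "\<And>x. x \<in> ball 0 1 \<Longrightarrow> P x = Q x"
    using uniformly_continuous_on_extension_on_closure by metis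
  have cl: "closure (ball (0::complex) 1) = cball 0 1" by simp
  have Qc: "continuous_on (cball 0 1) Q"
    using Q(1) uniformly_continuous_imp_continuous unfolding cl by blast
  define G where "G z = Q z - Q 0" for z
  have Gc: "continuous_on (cball 0 1) G" unfolding G_def by (intro continuous_intros Qc)
  have dG: "(G has_field_derivative exp (g z)) (at z)" if z: "z \<in> ball 0 1" for z
  proof -
    have "(P has_field_derivative exp (g z)) (at z)"
      using P[OF z] at_within_open[OF z open_ball] by simp
    then have "(Q has_field_derivative exp (g z)) (at z)"
      by (rule has_field_derivative_transform_within_open[OF _ open_ball z]) (use Q(2) in auto)
    then show ?thesis unfolding G_def by (auto intro!: derivative_eq_intros)
  qed
  have G1: "cmod (G z) \<le> 1/2" if "z \<in> cball 0 1" for z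
  proof (rule continuous_on_closure_norm_le[where f = G and s = "ball 0 1" and x = z])
    show "continuous_on (closure (ball 0 1)) G" unfolding cl by (rule Gc)
    show "\<forall>y\<in>ball 0 1. cmod (G y) \<le> 1/2"
    proof
      fix y :: complex assume y: "y \<in> ball 0 1"
      then show "cmod (G y) \<le> 1/2"
        using lip[of y 0] Q(2)[of y] Q(2)[of 0] by (simp add: G_def)
    qed
    show "z \<in> closure (ball 0 1)" unfolding cl by (rule that)
  qed
  have "riemann_hilbert_step \<psi> F G g u"
    unfolding riemann_hilbert_step_def using pair u Gc dG by (simp add: G_def)
  moreover have "half_disc_map G" unfolding half_disc_map_def using Gc G1 by blast
  ultimately show ?thesis by blast
qed

text \<open>
  The boundary values of \<open>Re g1\<close> and \<open>Re g2\<close> differ by at most \<open>4/3 * d\<close>. Since \<open>|exp g1|\<close> and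
  \<open>|exp g2|\<close> are at most \<open>1/16\<close>, the derivative of \<open>G1 - G2\<close> is bounded by
  \<open>1/16 * 4/3 * d\<close> times the logarithmic factor, whose integral along radii is at most \<open>5\<close>. The
  product \<open>5/12 * d\<close> is below \<open>d / 2\<close>.
\<close>

lemma riemann_hilbert_step_contraction:
  assumes \<psi>: "\<And>z. z \<in> sphere 0 1 \<Longrightarrow> exp (\<psi> z) \<le> 1/16"
    and F: "half_disc_map F1" "half_disc_map F2"
    and step: "riemann_hilbert_step \<psi> F1 G1 g1 u1" "riemann_hilbert_step \<psi> F2 G2 g2 u2"
    and d: "\<And>z. z \<in> cball 0 1 \<Longrightarrow> cmod (F1 z - F2 z) \<le> d" and z: "z \<in> cball 0 1"
  shows "cmod (G1 z - G2 z) \<le> d / 2"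
proof -
  have d0: "d \<ge> 0" using d[OF z] norm_ge_zero order_trans by blast
  have p: "schwarz_pair g1 u1" "schwarz_pair g2 u2"
    and u1: "\<And>z. z \<in> sphere 0 1 \<Longrightarrow> u1 z = \<psi> z + ln (1 - (cmod (F1 z))\<^sup>2)"
    and u2: "\<And>z. z \<in> sphere 0 1 \<Longrightarrow> u2 z = \<psi> z + ln (1 - (cmod (F2 z))\<^sup>2)"
    and Gc: "continuous_on (cball 0 1) G1" "continuous_on (cball 0 1) G2" and G0: "G1 0 = 0" "G2 0 = 0"
    and dG: "\<And>z. z \<in> ball 0 1 \<Longrightarrow> (G1 has_field_derivative exp (g1 z)) (at z)"
      "\<And>z. z \<in> ball 0 1 \<Longrightarrow> (G2 has_field_derivative exp (g2 z)) (at z)"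
    using step by (auto simp: riemann_hilbert_step_def)
  have ud: "\<bar>u1 z - u2 z\<bar> \<le> 4/3 * d" if z: "z \<in> sphere 0 1" for z
  proof -
    have "cmod (F1 z) \<le> 1/2" "cmod (F2 z) \<le> 1/2" "cmod (F1 z - F2 z) \<le> d"
      using F z d by (auto simp: half_disc_map_def)
    then show ?thesis
      using ln_one_minus_norm_sq_lipschitz[of "F1 z" "F2 z"] u1[OF z] u2[OF z] by simp
  qed
  have gd: "cmod (g1 z - g2 z) \<le> 4/3 * d * (1 - 4 * ln (1 - cmod z))" if "z \<in> ball 0 1" for z
    by (rule schwarz_pair_bound(2)[OF p ud that])
  have dH: "((\<lambda>z. G1 z - G2 z) has_field_derivative exp (g1 z) - exp (g2 z)) (at z)" if "z \<in> ball 0 1" for z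
    by (intro DERIV_diff dG that)
  have "cmod (G1 y - G2 y) \<le> 5 * (d / 12)" if y: "y \<in> ball 0 1" for y
  proof (rule norm_le_of_log_deriv_bound[where H = "\<lambda>z. G1 z - G2 z"])
    show "(\<lambda>z. G1 z - G2 z) holomorphic_on ball 0 1"
      unfolding holomorphic_on_open[OF open_ball] using dH by blast
    show "cmod (deriv (\<lambda>z. G1 z - G2 z) w) \<le> d / 12 * (1 - 4 * ln (1 - cmod w))" if w: "w \<in> ball 0 1" for w
    proof -
      have "deriv (\<lambda>z. G1 z - G2 z) w = exp (g1 w) - exp (g2 w)"
        using dH[OF w] by (rule DERIV_imp_deriv)
      moreover have "cmod (exp (g1 w) - exp (g2 w)) \<le> 1/16 * cmod (g1 w - g2 w)"
        by (intro norm_exp_diff_le riemann_hilbert_step_exp_bound[OF \<psi> F(1) p(1) u1 w]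
            riemann_hilbert_step_exp_bound[OF \<psi> F(2) p(2) u2 w])
      ultimately have "cmod (deriv (\<lambda>z. G1 z - G2 z) w) \<le> 1/16 * cmod (g1 w - g2 w)"
        by simp
      also have "\<dots> \<le> 1/16 * (4/3 * d * (1 - 4 * ln (1 - cmod w)))"
        by (intro mult_left_mono gd w) simp
      finally show ?thesis by (simp add: algebra_simps)
    qed
  qed (use G0 d0 y in auto)
  then have "\<forall>y\<in>ball 0 1. cmod (G1 y - G2 y) \<le> d / 2" using d0 by force
  moreover have cl: "closure (ball (0::complex) 1) = cball 0 1" by simp
  ultimately show ?thesis
    using continuous_on_closure_norm_le[of "ball 0 1" "\<lambda>y. G1 y - G2 y" "d / 2" z] z Gc
    unfolding cl by (auto intro: continuous_on_diff)
qed

text \<open>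
  Banach's fixed-point argument for sup-norm convergence on the closed disc, starting at \<open>0\<close>. The
  functions \<open>g\<close> of the iteration converge too, and this identifies the derivative of the limit.
\<close>

lemma riemann_hilbert_fixed_point:
  assumes \<psi>c: "continuous_on (sphere 0 1) \<psi>" and \<psi>: "\<And>z. z \<in> sphere 0 1 \<Longrightarrow> exp (\<psi> z) \<le> 1/16"
  shows "\<exists>F g u. half_disc_map F \<and> riemann_hilbert_step \<psi> F F g u"
proof -
  have "\<forall>F. \<exists>G. half_disc_map F \<longrightarrow> (\<exists>g u. riemann_hilbert_step \<psi> F G g u \<and> half_disc_map G)"
    using riemann_hilbert_step_exists[OF \<psi>c \<psi>] by blast
  then obtain T where T: "\<And>F. half_disc_map F \<Longrightarrow> \<exists>g u. riemann_hilbert_step \<psi> F (T F) g u \<and> half_disc_map (T F)"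
    by metis
  define F where "F n = (T ^^ n) (\<lambda>_. 0)" for n
  have F0: "F 0 = (\<lambda>_. 0)" and FS: "F (Suc n) = T (F n)" for n
    by (simp_all add: F_def)
  have small: "half_disc_map (F n)" for n
  proof (induction n)
    case 0
    then show ?case by (simp add: F0 half_disc_map_def)
  next
    case (Suc n)
    then show ?case using T FS by metis
  qed
  have "\<forall>n. \<exists>g u. riemann_hilbert_step \<psi> (F n) (F (Suc n)) g u"
    using T[OF small] FS by metis
  then obtain g u where step: "\<And>n. riemann_hilbert_step \<psi> (F n) (F (Suc n)) (g n) (u n)"
    by metis
  have F1: "cmod (F (Suc n) z - F n z) \<le> (1/2) ^ n" if "z \<in> cball 0 1" for n z
    using that
  proof (induction n arbitrary: z)
    case 0
    then have "cmod (F 1 z) \<le> 1/2" using small[of 1] by (simp add: half_disc_map_def)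
    then show ?case by (simp add: F0)
  next
    case (Suc n)
    show ?case
      using riemann_hilbert_step_contraction[OF \<psi> small small step step Suc.IH Suc.prems] by simp
  qed
  have Fk: "cmod (F (n + k) z - F n z) \<le> 2 * (1/2) ^ n - 2 * (1/2) ^ (n + k)" if "z \<in> cball 0 1" for n k z
  proof (induction k)
    case (Suc k)
    have "cmod (F (n + Suc k) z - F n z) \<le> cmod (F (Suc (n + k)) z - F (n + k) z) + cmod (F (n + k) z - F n z)"
      using norm_triangle_ineq[of "F (Suc (n + k)) z - F (n + k) z" "F (n + k) z - F n z"] by simp
    also have "\<dots> \<le> (1/2) ^ (n + k) + (2 * (1/2) ^ n - 2 * (1/2) ^ (n + k))"
      by (intro add_mono F1[OF that] Suc.IH)
    finally show ?case by simp
  qed simp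
  have Fd: "cmod (F m z - F n z) \<le> 2 * (1/2) ^ n" if "z \<in> cball 0 1" "n \<le> m" for m n z
  proof -
    have "2 * (1/2::real) ^ n - 2 * (1/2) ^ m \<le> 2 * (1/2) ^ n" by simp
    moreover have "cmod (F m z - F n z) \<le> 2 * (1/2) ^ n - 2 * (1/2) ^ m"
      using Fk[OF that(1), of n "m - n"] that(2) by simp
    ultimately show ?thesis by (rule order_trans[rotated])
  qed
  have FN: "\<exists>N. \<forall>z\<in>cball 0 1. \<forall>m\<ge>N. \<forall>n\<ge>N. cmod (F m z - F n z) < e" if "e > 0" for e
  proof -
    have "e / 4 > 0" "(1/2::real) < 1" using that by simp_all
    then obtain N where N: "(1/2::real) ^ N < e / 4"
      using real_arch_pow_inv by blast
    have "cmod (F m z - F n z) < e" if "z \<in> cball 0 1" "m \<ge> N" "n \<ge> N" for m n z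
    proof -
      have "cmod (F m z - F n z) \<le> cmod (F m z - F N z) + cmod (F n z - F N z)"
        using norm_triangle_ineq4[of "F m z - F N z" "F n z - F N z"] by simp
      then show ?thesis using Fd[OF that(1,2)] Fd[OF that(1,3)] N by linarith
    qed
    then show ?thesis by blast
  qed
  then have "uniformly_Cauchy_on (cball 0 1) F"
    unfolding uniformly_Cauchy_on_def dist_norm by blast
  then obtain F' where F': "uniform_limit (cball 0 1) F F' sequentially"
    using Cauchy_uniformly_convergent uniformly_convergent_on_def by metis
  have lim: "(\<lambda>n. F n z) \<longlonglongrightarrow> F' z" if "z \<in> cball 0 1" for z
    using F' that by (rule tendsto_uniform_limitI)
  have F'c: "continuous_on (cball 0 1) F'"
    by (rule uniform_limit_theorem[OF _ F']) (use small in \<open>auto simp: half_disc_map_def\<close>)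
  have F'1: "cmod (F' z) \<le> 1/2" if z: "z \<in> cball 0 1" for z
    by (rule tendsto_upperbound[OF tendsto_norm[OF lim[OF z]]])
      (use small z in \<open>auto simp: half_disc_map_def\<close>)
  have F's: "half_disc_map F'" using F'c F'1 by (simp add: half_disc_map_def)
  have ueq: "u n z = \<psi> z + ln (1 - (cmod (F n z))\<^sup>2)" if "z \<in> sphere 0 1" for n z
    using step[of n] that by (simp add: riemann_hilbert_step_def)
  have pair: "schwarz_pair (g n) (u n)" for n
    using step[of n] by (simp add: riemann_hilbert_step_def)
  have "uniformly_Cauchy_on (sphere 0 1) u"
    unfolding uniformly_Cauchy_on_def
  proof (intro allI impI)
    fix e :: real assume "e > 0"
    then have "e / 2 > 0" by simp
    then obtain N where N: "\<And>z m n. z \<in> cball 0 1 \<Longrightarrow> m \<ge> N \<Longrightarrow> n \<ge> N \<Longrightarrow> cmod (F m z - F n z) < e / 2"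
      using FN by blast
    have "dist (u m z) (u n z) < e" if z: "z \<in> sphere 0 1" and mn: "m \<ge> N" "n \<ge> N" for m n z
    proof -
      have z': "z \<in> cball 0 1" using z by auto
      have "cmod (F m z) \<le> 1/2" "cmod (F n z) \<le> 1/2"
        using small z' unfolding half_disc_map_def by blast+
      from ln_one_minus_norm_sq_lipschitz[OF this]
      have "dist (u m z) (u n z) \<le> 4/3 * cmod (F m z - F n z)"
        using ueq[OF z] by (simp add: dist_real_def)
      also have "\<dots> < e" using N[OF z' mn] \<open>e > 0\<close> by simp
      finally show ?thesis .
    qed
    then show "\<exists>M. \<forall>x\<in>sphere 0 1. \<forall>m\<ge>M. \<forall>n\<ge>M. dist (u m x) (u n x) < e" by blast
  qed
  then obtain g' u' where g': "schwarz_pair g' u'" and u': "uniform_limit (cball 0 1) u u' sequentially"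
    and glim: "\<And>z. z \<in> ball 0 1 \<Longrightarrow> (\<lambda>n. g n z) \<longlonglongrightarrow> g' z"
    using schwarz_pair_limit[of g u, OF pair] by blast
  have u'eq: "u' z = \<psi> z + ln (1 - (cmod (F' z))\<^sup>2)" if z: "z \<in> sphere 0 1" for z
  proof -
    have z': "z \<in> cball 0 1" using z by auto
    have "3/4 \<le> 1 - (cmod (F' z))\<^sup>2" using F'1[OF z'] by (rule half_disc_gap)
    then have "1 - (cmod (F' z))\<^sup>2 \<noteq> 0" by simp
    then have "(\<lambda>n. \<psi> z + ln (1 - (cmod (F n z))\<^sup>2)) \<longlonglongrightarrow> \<psi> z + ln (1 - (cmod (F' z))\<^sup>2)"
      by (intro tendsto_intros lim z')
    then have "(\<lambda>n. u n z) \<longlonglongrightarrow> \<psi> z + ln (1 - (cmod (F' z))\<^sup>2)"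
      by (simp add: ueq[OF z])
    then show ?thesis
      using tendsto_uniform_limitI[OF u' z'] LIMSEQ_unique by blast
  qed
  have "\<exists>h. \<forall>x\<in>ball 0 1. (F' has_field_derivative h x) (at x) \<and> ((\<lambda>n. exp (g n x)) \<longlonglongrightarrow> h x)"
  proof (rule has_complex_derivative_uniform_sequence[OF open_ball, where f = "\<lambda>n. F (Suc n)"])
    show "(F (Suc n) has_field_derivative exp (g n x)) (at x)" if "x \<in> ball 0 1" for n x
      using step[of n] that by (simp add: riemann_hilbert_step_def)
    show "\<exists>d>0. cball x d \<subseteq> ball 0 1 \<and> uniform_limit (cball x d) (\<lambda>n. F (Suc n)) F' sequentially"
      if x: "x \<in> ball 0 1" for x
    proof -
      obtain d where d: "d > 0" "cball x d \<subseteq> ball 0 1"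
        using x open_contains_cball by (meson open_ball)
      have "uniform_limit (cball 0 1) (\<lambda>n. F (Suc n)) F' sequentially"
        using filterlim_compose[OF F' filterlim_Suc] by simp
      then have "uniform_limit (cball x d) (\<lambda>n. F (Suc n)) F' sequentially"
        by (rule uniform_limit_on_subset) (use d in auto)
      then show ?thesis using d by blast
    qed
  qed
  then obtain h where h: "\<And>x. x \<in> ball 0 1 \<Longrightarrow> (F' has_field_derivative h x) (at x)"
    "\<And>x. x \<in> ball 0 1 \<Longrightarrow> (\<lambda>n. exp (g n x)) \<longlonglongrightarrow> h x" by blast
  have "h x = exp (g' x)" if "x \<in> ball 0 1" for x
    using h(2)[OF that] tendsto_exp[OF glim[OF that]] LIMSEQ_unique by blast
  then have "\<forall>z\<in>ball 0 1. (F' has_field_derivative exp (g' z)) (at z)"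
    using h(1) by metis
  moreover have "F' 0 = 0"
  proof -
    have "F n 0 = 0" for n
      using step[of "n - 1"] F0 by (cases n) (auto simp: riemann_hilbert_step_def)
    then show ?thesis using lim[of 0] LIMSEQ_unique[OF tendsto_const] by fastforce
  qed
  ultimately have "riemann_hilbert_step \<psi> F' F' g' u'"
    unfolding riemann_hilbert_step_def using g' u'eq F'c by blast
  then show ?thesis using F's by blast
qed

text \<open>
  The bound \<open>1/2\<close> on \<open>F\<close> is part of the notion because it keeps limits of solutions inside the unit disc.
\<close>

definition solves_liouville_dirichlet ::
    "complex \<Rightarrow> real \<Rightarrow> (complex \<Rightarrow> real) \<Rightarrow> (complex \<Rightarrow> complex) \<Rightarrow> (complex \<Rightarrow> real) \<Rightarrow> bool" where
  "solves_liouville_dirichlet a R \<phi> F w \<longleftrightarrow>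
     F holomorphic_on ball a R \<and>
     (\<forall>z\<in>ball a R. cmod (F z) \<le> 1/2 \<and> deriv F z \<noteq> 0 \<and> w z = liouville_density F z) \<and>
     continuous_on (cball a R) w \<and> (\<forall>z\<in>cball a R. 0 < w z) \<and> (\<forall>z\<in>sphere a R. w z = \<phi> z)"

lemma liouville_dirichlet_unit_disc:
  assumes \<phi>c: "continuous_on (sphere 0 1) \<phi>"
    and \<phi>: "\<And>z. z \<in> sphere 0 1 \<Longrightarrow> 0 < \<phi> z" "\<And>z. z \<in> sphere 0 1 \<Longrightarrow> \<phi> z \<le> 1/8"
  shows "\<exists>F w. solves_liouville_dirichlet 0 1 \<phi> F w"
proof -
  define \<psi> where "\<psi> z = ln (\<phi> z / 2)" for z
  have "continuous_on (sphere 0 1) \<psi>"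
    unfolding \<psi>_def using \<phi>(1) by (intro continuous_intros \<phi>c) (metis divide_pos_pos less_irrefl zero_less_numeral)+
  moreover have exp\<psi>: "exp (\<psi> z) = \<phi> z / 2" if "z \<in> sphere 0 1" for z
    using \<phi>(1)[OF that] by (simp add: \<psi>_def)
  moreover have "exp (\<psi> z) \<le> 1/16" if "z \<in> sphere 0 1" for z
    using exp\<psi>[OF that] \<phi>(2)[OF that] by simp
  ultimately obtain F g u where F: "half_disc_map F" and step: "riemann_hilbert_step \<psi> F F g u"
    using riemann_hilbert_fixed_point[of \<psi>] by blast
  have dF: "\<And>z. z \<in> ball 0 1 \<Longrightarrow> (F has_field_derivative exp (g z)) (at z)"
    and pair: "schwarz_pair g u" and Fc: "continuous_on (cball 0 1) F"
    and u: "\<And>z. z \<in> sphere 0 1 \<Longrightarrow> u z = \<psi> z + ln (1 - (cmod (F z))\<^sup>2)"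
    using step by (auto simp: riemann_hilbert_step_def)
  have F1: "cmod (F z) \<le> 1/2" if "z \<in> cball 0 1" for z
    using F that by (auto simp: half_disc_map_def)
  have pos: "0 < 1 - (cmod (F z))\<^sup>2" if "z \<in> cball 0 1" for z
  proof -
    have "3/4 \<le> 1 - (cmod (F z))\<^sup>2" using F1[OF that] by (rule half_disc_gap)
    then show ?thesis by simp
  qed
  define w where "w z = 2 * exp (u z) / (1 - (cmod (F z))\<^sup>2)" for z
  have dF': "deriv F z = exp (g z)" if "z \<in> ball 0 1" for z
    using dF[OF that] by (rule DERIV_imp_deriv)
  have uc: "continuous_on (cball 0 1) u" using pair by (simp add: schwarz_pair_def)
  have "solves_liouville_dirichlet 0 1 \<phi> F w"
    unfolding solves_liouville_dirichlet_def
  proof (intro conjI ballI)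
    show "F holomorphic_on ball 0 1"
      unfolding holomorphic_on_open[OF open_ball] using dF by blast
    show "continuous_on (cball 0 1) w"
      unfolding w_def using pos by (intro continuous_intros Fc uc) (metis less_irrefl)
    show "0 < w z" if "z \<in> cball 0 1" for z using pos[OF that] by (simp add: w_def)
    show "w z = liouville_density F z" if "z \<in> ball 0 1" for z
      using pair that by (simp add: w_def liouville_density_def dF'[OF that] schwarz_pair_def)
    show "w z = \<phi> z" if "z \<in> sphere 0 1" for z
      using pos[of z] that by (simp add: w_def u exp_add exp\<psi>)
  qed (use dF' F1 in auto)
  then show ?thesis by blast
qed

lemma liouville_density_affine:
  assumes "R > 0" "F field_differentiable at ((z - a) / of_real R)"
  shows "liouville_density (\<lambda>z. F ((z - a) / of_real R)) z = liouville_density F ((z - a) / of_real R) / R"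
proof -
  have "((\<lambda>z. (z - a) / of_real R) has_field_derivative 1 / of_real R) (at z)"
    using assms(1) by (auto intro!: derivative_eq_intros)
  then have "((\<lambda>z. F ((z - a) / of_real R)) has_field_derivative deriv F ((z - a) / of_real R) * (1 / of_real R)) (at z)"
    by (rule DERIV_chain2[rotated]) (use assms(2) in \<open>simp add: field_differentiable_derivI\<close>)
  then have "deriv (\<lambda>z. F ((z - a) / of_real R)) z = deriv F ((z - a) / of_real R) / of_real R"
    by (simp add: DERIV_imp_deriv)
  then show ?thesis using assms(1) by (simp add: liouville_density_def norm_divide)
qed

text \<open>
  The unit disc suffices: if \<open>F\<close> solves the problem there for \<open>R * \<phi>\<close>, transplanted to the unit circle,
  then \<open>F ((z - a) / R)\<close> has a density that carries the chain-rule factor \<open>1 / R\<close>.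
\<close>

lemma liouville_dirichlet:
  fixes a :: complex
  assumes R: "R > 0" and \<phi>c: "continuous_on (sphere a R) \<phi>"
    and \<phi>: "\<And>z. z \<in> sphere a R \<Longrightarrow> 0 < \<phi> z" "\<And>z. z \<in> sphere a R \<Longrightarrow> R * \<phi> z \<le> 1/8"
  shows "\<exists>F w. solves_liouville_dirichlet a R \<phi> F w"
proof -
  have in_s: "a + of_real R * z \<in> sphere a R" if "z \<in> sphere 0 1" for z
    using that R by (simp add: dist_norm norm_mult)
  have "continuous_on (sphere 0 1) (\<lambda>z. R * \<phi> (a + of_real R * z))"
    by (intro continuous_intros continuous_on_compose2[OF \<phi>c]) (use in_s in auto)
  then obtain F w where sol: "solves_liouville_dirichlet 0 1 (\<lambda>z. R * \<phi> (a + of_real R * z)) F w"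
    using liouville_dirichlet_unit_disc[of "\<lambda>z. R * \<phi> (a + of_real R * z)"] \<phi> in_s R by force
  have F: "F holomorphic_on ball 0 1" "\<And>z. z \<in> ball 0 1 \<Longrightarrow> cmod (F z) \<le> 1/2"
    and w: "continuous_on (cball 0 1) w" "\<And>z. z \<in> cball 0 1 \<Longrightarrow> 0 < w z"
    "\<And>z. z \<in> ball 0 1 \<Longrightarrow> w z = liouville_density F z"
    "\<And>z. z \<in> sphere 0 1 \<Longrightarrow> w z = R * \<phi> (a + of_real R * z)"
    using sol unfolding solves_liouville_dirichlet_def by blast+
  define T where "T z = (z - a) / of_real R" for z
  have Tn: "cmod (T z) = dist a z / R" for z
    using R by (simp add: T_def norm_divide dist_norm norm_minus_commute)
  have Tb: "T z \<in> ball 0 1" if "z \<in> ball a R" for z using that R by (simp add: Tn)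
  have Tc: "T z \<in> cball 0 1" if "z \<in> cball a R" for z using that R by (simp add: Tn)
  have Ts: "T z \<in> sphere 0 1" if "z \<in> sphere a R" for z using that R by (simp add: Tn)
  have Th: "T holomorphic_on S" for S unfolding T_def using R by (intro holomorphic_intros) auto
  have a_T: "a + of_real R * T z = z" for z using R by (simp add: T_def)
  have fd: "F field_differentiable at (T z)" if "z \<in> ball a R" for z
    using F(1) Tb[OF that] by (meson holomorphic_on_imp_differentiable_at open_ball)
  have den: "liouville_density (\<lambda>z. F (T z)) z = liouville_density F (T z) / R" if "z \<in> ball a R" for z
    unfolding T_def by (rule liouville_density_affine[OF R]) (use fd[OF that] in \<open>simp add: T_def\<close>)
  have dpos: "0 < liouville_density F (T z)" if "z \<in> ball a R" for z
    using w(2)[of "T z"] w(3)[OF Tb[OF that]] Tb[OF that] by simp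
  have "solves_liouville_dirichlet a R \<phi> (\<lambda>z. F (T z)) (\<lambda>z. w (T z) / R)"
    unfolding solves_liouville_dirichlet_def
  proof (intro conjI ballI)
    show "(\<lambda>z. F (T z)) holomorphic_on ball a R"
      using holomorphic_on_compose_gen[OF Th[of "ball a R"] F(1)] Tb by (simp add: o_def image_subset_iff)
    show "deriv (\<lambda>z. F (T z)) z \<noteq> 0" if "z \<in> ball a R" for z
    proof
      assume "deriv (\<lambda>z. F (T z)) z = 0"
      then have "liouville_density (\<lambda>z. F (T z)) z = 0" by (simp add: liouville_density_def)
      then show False using den[OF that] dpos[OF that] R by simp
    qed
    show "continuous_on (cball a R) (\<lambda>z. w (T z) / R)"
      by (intro continuous_intros continuous_on_compose2[OF w(1)] holomorphic_on_imp_continuous_on[OF Th])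
        (use Tc R in auto)
    show "w (T z) / R = liouville_density (\<lambda>z. F (T z)) z" if "z \<in> ball a R" for z
      using den[OF that] w(3)[OF Tb[OF that]] by simp
    show "w (T z) / R = \<phi> z" if "z \<in> sphere a R" for z
      using w(4)[OF Ts[OF that]] R by (simp add: a_T)
    show "0 < w (T z) / R" if "z \<in> cball a R" for z
      using w(2)[OF Tc[OF that]] R by simp
  qed (use F(2) Tb in auto)
  then show ?thesis by blast
qed

section \<open>Comparison principles\<close>

lemma lower_laplacian_cong:
  assumes "e > 0" and "\<And>w. w \<in> ball z e \<Longrightarrow> u w = v w"
  shows "lower_laplacian u z = lower_laplacian v z"
  unfolding lower_laplacian_def
proof (rule Liminf_eq)
  have "\<forall>\<^sub>F r in at_right 0. r < e" "\<forall>\<^sub>F r in at_right 0. 0 < (r::real)"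
    using assms(1) by (auto simp: eventually_at_right_field)
  then show "\<forall>\<^sub>F r in at_right 0.
      ereal (4 / r\<^sup>2 * (1 / (2 * pi) * integral {0..2 * pi} (\<lambda>t. u (z + of_real r * exp (\<i> * of_real t))) - u z))
      = ereal (4 / r\<^sup>2 * (1 / (2 * pi) * integral {0..2 * pi} (\<lambda>t. v (z + of_real r * exp (\<i> * of_real t))) - v z))"
  proof eventually_elim
    case (elim r)
    have "u (z + of_real r * exp (\<i> * of_real t)) = v (z + of_real r * exp (\<i> * of_real t))" for t
      using elim by (intro assms(2)) (simp add: dist_norm norm_mult)
    moreover have "u z = v z" using assms by simp
    ultimately show ?case by simp
  qed
qed

text \<open>
  The inequality \<open>\<Delta> (ln l) \<ge> l^2\<close>, which for \<open>l z > 0\<close> is the curvature bound without its sign and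
  quotient.
\<close>

definition log_subsolution_at :: "(complex \<Rightarrow> real) \<Rightarrow> complex \<Rightarrow> bool" where
  "log_subsolution_at l z \<longleftrightarrow> ereal ((l z)\<^sup>2) \<le> lower_laplacian (\<lambda>w. ln (l w)) z"

lemma curvature_le_iff:
  assumes "l z > 0"
  shows "curvature l z \<le> -1 \<longleftrightarrow> log_subsolution_at l z"
proof (cases "lower_laplacian (\<lambda>w. ln (l w)) z")
  case (real x)
  have "- x / (l z)\<^sup>2 \<le> -1 \<longleftrightarrow> (l z)\<^sup>2 \<le> x"
    using assms by (simp add: field_simps)
  then show ?thesis
    using real assms by (simp add: curvature_def log_subsolution_at_def one_ereal_def)
qed (use assms in \<open>simp_all add: curvature_def log_subsolution_at_def one_ereal_def\<close>)

lemma SK_metric_iff: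
  "SK_metric G l \<longleftrightarrow> conformal_pseudo_metric G l \<and> (\<forall>z\<in>G. l z > 0 \<longrightarrow> log_subsolution_at l z)"
  by (auto simp: SK_metric_def curvature_le_iff)

lemma positive_on_ball:
  fixes f :: "complex \<Rightarrow> real"
  assumes "open S" "continuous_on S f" "z \<in> S" "f z > 0"
  shows "\<exists>e>0. ball z e \<subseteq> S \<and> (\<forall>w\<in>ball z e. f w > 0)"
proof -
  have "open (S \<inter> f -` {0<..})"
    by (intro continuous_open_preimage assms) auto
  moreover have "z \<in> S \<inter> f -` {0<..}" using assms by auto
  ultimately obtain e where e: "e > 0" "ball z e \<subseteq> S \<inter> f -` {0<..}"
    by (rule openE)
  then show ?thesis by (intro exI[of _ e]) auto
qed

text \<open>
  Raising \<open>l\<close> away from \<open>z\<close> can only increase circle means around \<open>z\<close>.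
\<close>

lemma log_subsolution_at_touching:
  assumes S: "open S" "z \<in> S" and l: "continuous_on S l" and m: "continuous_on S m"
    and le: "\<And>w. w \<in> S \<Longrightarrow> l w \<le> m w" and eq: "m z = l z" and pos: "l z > 0"
    and sub: "log_subsolution_at l z"
  shows "log_subsolution_at m z"
proof -
  obtain e where e: "e > 0" "ball z e \<subseteq> S" "\<And>w. w \<in> ball z e \<Longrightarrow> l w > 0"
    using positive_on_ball[OF S(1) l S(2) pos] by blast
  have mpos: "m w > 0" if "w \<in> ball z e" for w
    using le[of w] e(2) e(3)[OF that] that by force
  have "lower_laplacian (\<lambda>w. ln (l w)) z \<le> lower_laplacian (\<lambda>w. ln (m w)) z"
  proof (rule lower_laplacian_mono[OF e(1)])
    show "continuous_on (ball z e) (\<lambda>w. ln (l w))"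
      using e(3) by (intro continuous_intros continuous_on_subset[OF l e(2)]) (metis less_irrefl)
    show "continuous_on (ball z e) (\<lambda>w. ln (m w))"
      using mpos by (intro continuous_intros continuous_on_subset[OF m e(2)]) (metis less_irrefl)
    show "ln (l w) - ln (l z) \<le> ln (m w) - ln (m z)" if "w \<in> ball z e" for w
      using le[of w] e(2) e(3)[OF that] mpos[OF that] that eq by (auto simp: ln_le_cancel_iff)
  qed
  then show ?thesis using sub eq by (auto simp: log_subsolution_at_def)
qed

lemma lower_laplacian_ln_of_liouville:
  assumes "open S" "z \<in> S" "F holomorphic_on S" "\<And>w. w \<in> S \<Longrightarrow> cmod (F w) < 1"
    and "deriv F z \<noteq> 0" and w: "\<And>y. y \<in> S \<Longrightarrow> w y = liouville_density F y"
  shows "lower_laplacian (\<lambda>y. ln (w y)) z = ereal ((w z)\<^sup>2)"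
proof -
  obtain e where "e > 0" "ball z e \<subseteq> S" using assms(1,2) by (rule openE)
  then have "lower_laplacian (\<lambda>y. ln (w y)) z = lower_laplacian (\<lambda>y. ln (liouville_density F y)) z"
    by (intro lower_laplacian_cong) (use w in auto)
  then show ?thesis
    using lower_laplacian_ln_liouville_density[OF assms(1-5)] w[OF assms(2)] by simp
qed

text \<open>
  At a maximum of \<open>l / w\<close> the lower Laplacian of \<open>ln l\<close> is at most that of \<open>ln w\<close>, that is
  \<open>l^2 \<le> w^2\<close>.
\<close>

lemma comparison_at_max:
  assumes S: "open S" "z \<in> S" and l: "continuous_on S l" and w: "continuous_on S w"
    and wpos: "\<And>y. y \<in> S \<Longrightarrow> w y > 0" and pos: "l z > 0" and sub: "log_subsolution_at l z"
    and lap: "lower_laplacian (\<lambda>y. ln (w y)) z = ereal ((w z)\<^sup>2)"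
    and max: "\<And>y. y \<in> S \<Longrightarrow> l y / w y \<le> l z / w z"
  shows "l z \<le> w z"
proof -
  obtain e where e: "e > 0" "ball z e \<subseteq> S" "\<And>w. w \<in> ball z e \<Longrightarrow> l w > 0"
    using positive_on_ball[OF S(1) l S(2) pos] by blast
  have wp: "w y > 0" if "y \<in> ball z e" for y using wpos e(2) that by blast
  have "lower_laplacian (\<lambda>w. ln (l w)) z \<le> lower_laplacian (\<lambda>y. ln (w y)) z"
  proof (rule lower_laplacian_mono[OF e(1)])
    show "continuous_on (ball z e) (\<lambda>w. ln (l w))"
      using e(3) by (intro continuous_intros continuous_on_subset[OF l e(2)]) (metis less_irrefl)
    show "continuous_on (ball z e) (\<lambda>y. ln (w y))"
      using wp by (intro continuous_intros continuous_on_subset[OF w e(2)]) (metis less_irrefl)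
    show "ln (l y) - ln (l z) \<le> ln (w y) - ln (w z)" if y: "y \<in> ball z e" for y
    proof -
      have "l y / w y \<le> l z / w z" using max e(2) y by blast
      then have "ln (l y / w y) \<le> ln (l z / w z)"
        using e(3)[OF y] wp[OF y] by (intro ln_mono) auto
      then show ?thesis
        using e(3)[OF y] wp[OF y] pos wpos[OF S(2)] by (simp add: ln_div)
    qed
  qed
  then have "(l z)\<^sup>2 \<le> (w z)\<^sup>2"
    using sub lap unfolding log_subsolution_at_def by (metis ereal_less_eq(3) order_trans)
  then show ?thesis
    by (rule power2_le_imp_le) (use wpos[OF S(2)] in simp)
qed

lemma comparison_on_disc:
  assumes l: "continuous_on (cball a R) l"
    and sub: "\<And>z. z \<in> ball a R \<Longrightarrow> l z > 0 \<Longrightarrow> log_subsolution_at l z"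
    and w: "continuous_on (cball a R) w" and wpos: "\<And>z. z \<in> cball a R \<Longrightarrow> w z > 0"
    and lap: "\<And>z. z \<in> ball a R \<Longrightarrow> lower_laplacian (\<lambda>y. ln (w y)) z = ereal ((w z)\<^sup>2)"
    and bd: "\<And>z. z \<in> sphere a R \<Longrightarrow> l z \<le> w z"
    and z: "z \<in> cball a R"
  shows "l z \<le> w z"
proof -
  have "continuous_on (cball a R) (\<lambda>z. l z / w z)"
    using wpos by (intro continuous_intros l w) (metis less_irrefl)
  then obtain \<xi> where \<xi>: "\<xi> \<in> cball a R" "\<And>y. y \<in> cball a R \<Longrightarrow> l y / w y \<le> l \<xi> / w \<xi>"
    using continuous_attains_sup[OF compact_cball, of a R "\<lambda>z. l z / w z"] z by blast
  have "l \<xi> \<le> w \<xi>"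
  proof (rule ccontr)
    assume "\<not> l \<xi> \<le> w \<xi>"
    then have gt: "w \<xi> < l \<xi>" by simp
    have \<xi>b: "\<xi> \<in> ball a R" using \<xi>(1) bd[of \<xi>] gt by (cases "\<xi> \<in> sphere a R") auto
    have lpos: "l \<xi> > 0" using gt wpos[OF \<xi>(1)] by linarith
    have "l \<xi> \<le> w \<xi>"
    proof (rule comparison_at_max[OF open_ball \<xi>b])
      show "continuous_on (ball a R) l" "continuous_on (ball a R) w"
        using l w by (auto intro: continuous_on_subset)
    qed (use wpos lpos sub[OF \<xi>b lpos] lap[OF \<xi>b] \<xi>(2) in auto)
    then show False using gt by simp
  qed
  then have "l z / w z \<le> 1"
    using \<xi>(2)[OF z] wpos[OF \<xi>(1)] by (simp add: order_trans divide_le_eq_1_pos)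
  then show ?thesis using wpos[OF z] by (simp add: divide_le_eq_1_pos)
qed

text \<open>
  The quotient of \<open>l\<close> by the hyperbolic metric of \<open>ball a s\<close> is, up to a constant, \<open>l z * (s^2 - |z - a|^2)\<close>.
  It is continuous on the closed disc and vanishes on the circle, so a positive maximum is attained
  inside, where \<open>comparison_at_max\<close> applies.
\<close>

lemma ahlfors_lemma:
  assumes s: "s > 0" and l: "continuous_on (cball a s) l"
    and sub: "\<And>z. z \<in> ball a s \<Longrightarrow> l z > 0 \<Longrightarrow> log_subsolution_at l z"
    and z: "z \<in> cball a s"
  shows "l z * (s\<^sup>2 - (cmod (z - a))\<^sup>2) \<le> 2 * s"
proof -
  define \<rho> where "\<rho> z = l z * (s\<^sup>2 - (cmod (z - a))\<^sup>2)" for z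
  define F where "F z = (z - a) / of_real s" for z
  define w where "w = liouville_density F"
  have Fh: "F holomorphic_on S" for S unfolding F_def using s by (intro holomorphic_intros) auto
  have dF: "deriv F z = 1 / of_real s" for z
  proof (rule DERIV_imp_deriv)
    show "(F has_field_derivative 1 / of_real s) (at z)"
      unfolding F_def using s by (auto intro!: derivative_eq_intros)
  qed
  have gap: "0 < s\<^sup>2 - (cmod (z - a))\<^sup>2" if "z \<in> ball a s" for z
    using that by (simp add: dist_norm norm_minus_commute power_strict_mono)
  have weq: "w z = 2 * s / (s\<^sup>2 - (cmod (z - a))\<^sup>2)" if "z \<in> ball a s" for z
    using gap[OF that] s
    by (simp add: w_def liouville_density_def dF) (simp add: F_def norm_divide power_divide field_simps power2_eq_square)
  have wpos: "w z > 0" if "z \<in> ball a s" for z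
    using gap[OF that] s by (simp add: weq[OF that])
  have rw: "l z / w z = \<rho> z / (2 * s)" if "z \<in> ball a s" for z
    using gap[OF that] s by (simp add: weq[OF that] \<rho>_def)
  have "continuous_on (cball a s) \<rho>"
    unfolding \<rho>_def by (intro continuous_intros l)
  then obtain \<xi> where \<xi>: "\<xi> \<in> cball a s" "\<And>y. y \<in> cball a s \<Longrightarrow> \<rho> y \<le> \<rho> \<xi>"
    using continuous_attains_sup[OF compact_cball, of a s \<rho>] z by blast
  have "\<rho> \<xi> \<le> 2 * s"
  proof (rule ccontr)
    assume "\<not> \<rho> \<xi> \<le> 2 * s"
    then have gt: "\<rho> \<xi> > 2 * s" by simp
    have "\<xi> \<notin> sphere a s"
    proof
      assume "\<xi> \<in> sphere a s"
      then have "\<rho> \<xi> = 0" by (simp add: \<rho>_def dist_norm norm_minus_commute)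
      then show False using gt s by simp
    qed
    then have \<xi>b: "\<xi> \<in> ball a s" using \<xi>(1) by auto
    have lpos: "l \<xi> > 0"
    proof (rule ccontr)
      assume "\<not> l \<xi> > 0"
      then have "\<rho> \<xi> \<le> 0"
        unfolding \<rho>_def using gap[OF \<xi>b] by (intro mult_nonpos_nonneg) auto
      then show False using gt s by simp
    qed
    have "continuous_on (ball a s) w"
      using gap by (subst continuous_on_cong[OF refl weq]) (auto intro!: continuous_intros simp: less_imp_neq[symmetric])
    then have "l \<xi> \<le> w \<xi>"
    proof (rule comparison_at_max[OF open_ball \<xi>b, rotated])
      show "continuous_on (ball a s) l" using l by (auto intro: continuous_on_subset)
      show "lower_laplacian (\<lambda>y. ln (w y)) \<xi> = ereal ((w \<xi>)\<^sup>2)"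
      proof (rule lower_laplacian_ln_of_liouville[OF open_ball \<xi>b Fh])
        show "cmod (F y) < 1" if "y \<in> ball a s" for y
          using that s by (simp add: F_def norm_divide dist_norm norm_minus_commute)
      qed (use s in \<open>auto simp: dF w_def\<close>)
      show "l y / w y \<le> l \<xi> / w \<xi>" if "y \<in> ball a s" for y
        using \<xi>(2)[of y] that s rw[OF that] rw[OF \<xi>b] by (simp add: divide_right_mono)
    qed (use wpos lpos sub[OF \<xi>b lpos] in auto)
    then have "l \<xi> / w \<xi> \<le> 1" using wpos[OF \<xi>b] by simp
    then show False using rw[OF \<xi>b] gt s by simp
  qed
  then show ?thesis using \<xi>(2)[OF z] by (simp add: \<rho>_def)
qed

section \<open>Compactness of Liouville densities\<close>

text \<open>
  The second alternative is density zero. With it the family is closed under locally uniform limits, by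
  Hurwitz's theorem; positive densities alone may degenerate to zero.
\<close>

definition liouville_family :: "complex set \<Rightarrow> (complex \<Rightarrow> complex) set" where
  "liouville_family D = {F. F holomorphic_on D \<and> (\<forall>z\<in>D. cmod (F z) \<le> 1/2) \<and>
     ((\<forall>z\<in>D. deriv F z \<noteq> 0) \<or> (\<forall>z\<in>D. deriv F z = 0))}"

text \<open>
  Montel's theorem gives limits of the maps and of their derivatives, and the latter limit is the
  derivative of the former. Hurwitz's theorem gives the dichotomy for the limit.
\<close>

lemma liouville_family_compact:
  assumes F: "\<And>n. F n \<in> liouville_family (ball a R)"
  obtains f r where "f \<in> liouville_family (ball a R)" "strict_mono (r :: nat \<Rightarrow> nat)"
    "\<And>z. z \<in> ball a R \<Longrightarrow> (\<lambda>n. liouville_density (F (r n)) z) \<longlonglongrightarrow> liouville_density f z"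
proof -
  define D where "D = ball a R"
  have D: "open D" "connected D" by (auto simp: D_def)
  define \<H> where "\<H> = {f. f holomorphic_on D \<and> (\<forall>z\<in>D. cmod (f z) \<le> 1/2)}"
  have FH: "F n \<in> \<H>" for n using F[of n] by (auto simp: \<H>_def liouville_family_def D_def)
  obtain f r1 where f: "f holomorphic_on D" and r1: "strict_mono (r1 :: nat \<Rightarrow> nat)"
    and lim1: "\<And>z. z \<in> D \<Longrightarrow> (\<lambda>n. F (r1 n) z) \<longlonglongrightarrow> f z"
    and ul1: "\<And>K. compact K \<Longrightarrow> K \<subseteq> D \<Longrightarrow> uniform_limit K (F \<circ> r1) f sequentially"
  proof (rule Montel[OF D(1), of \<H> F])
    show "\<exists>B. \<forall>h\<in>\<H>. \<forall>z\<in>K. cmod (h z) \<le> B" if "K \<subseteq> D" for K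
      using that by (intro exI[of _ "1/2"]) (auto simp: \<H>_def)
  qed (use FH in \<open>auto simp: \<H>_def\<close>)
  obtain h r2 where h: "h holomorphic_on D" and r2: "strict_mono (r2 :: nat \<Rightarrow> nat)"
    and lim2: "\<And>z. z \<in> D \<Longrightarrow> (\<lambda>n. deriv (F (r1 (r2 n))) z) \<longlonglongrightarrow> h z"
    and ul2: "\<And>K. compact K \<Longrightarrow> K \<subseteq> D \<Longrightarrow> uniform_limit K ((\<lambda>n. deriv (F (r1 n))) \<circ> r2) h sequentially"
  proof (rule Montel[OF D(1), of "deriv ` \<H>" "\<lambda>n. deriv (F (r1 n))"])
    show "g holomorphic_on D" if "g \<in> deriv ` \<H>" for g
      using that D by (auto simp: \<H>_def intro: holomorphic_deriv)
    show "range (\<lambda>n. deriv (F (r1 n))) \<subseteq> deriv ` \<H>" using FH by auto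
    show "\<exists>B. \<forall>h\<in>deriv ` \<H>. \<forall>z\<in>K. cmod (h z) \<le> B" if K: "compact K" "K \<subseteq> D" for K
    proof (cases "K = {}")
      case False
      have "continuous_on K (\<lambda>z. dist a z)" by (intro continuous_intros)
      then obtain k where k: "k \<in> K" "\<And>y. y \<in> K \<Longrightarrow> dist a y \<le> dist a k"
        using continuous_attains_sup[OF K(1) False] by blast
      define \<rho> where "\<rho> = R - dist a k"
      have \<rho>: "\<rho> > 0" using k(1) K(2) by (auto simp: \<rho>_def D_def)
      have "cmod (deriv g z) \<le> 4 * (1/2) / \<rho>" if g: "g \<in> \<H>" and z: "z \<in> K" for g z
      proof (rule norm_deriv_le_Re_bound[OF \<rho>])
        have sub: "ball z \<rho> \<subseteq> D"
        proof
          fix y assume "y \<in> ball z \<rho>"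
          then show "y \<in> D"
            using k(2)[OF z] dist_triangle[of a y z] by (simp add: \<rho>_def D_def)
        qed
        show "g holomorphic_on ball z \<rho>" using g sub by (auto simp: \<H>_def intro: holomorphic_on_subset)
        show "\<bar>Re (g w)\<bar> \<le> 1/2" if "w \<in> ball z \<rho>" for w
          using g sub that abs_Re_le_cmod[of "g w"] by (force simp: \<H>_def)
      qed
      then show ?thesis by blast
    qed simp
  qed auto
  define r where "r = r1 \<circ> r2"
  have r: "strict_mono r" using r1 r2 by (simp add: r_def strict_mono_o)
  have heq: "h z = deriv f z" if z: "z \<in> D" for z
  proof -
    obtain e where e: "e > 0" "cball z e \<subseteq> D" using D(1) z open_contains_cball by blast
    have "uniform_limit (ball z e) (F \<circ> r1) f sequentially"
      by (rule uniform_limit_on_subset[OF ul1[OF compact_cball e(2)]]) auto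
    then have "(\<lambda>n. deriv ((F \<circ> r1) n) z) \<longlonglongrightarrow> deriv f z"
    proof (rule deriv_complex_uniform_limit)
      show "\<forall>\<^sub>F n in sequentially. (F \<circ> r1) n holomorphic_on ball z e"
        using FH e(2) ball_subset_cball by (intro always_eventually allI) (fastforce simp: \<H>_def intro: holomorphic_on_subset)
    qed (use e in auto)
    then have "(\<lambda>n. deriv (F (r1 (r2 n))) z) \<longlonglongrightarrow> deriv f z"
      using LIMSEQ_subseq_LIMSEQ[OF _ r2, of "\<lambda>n. deriv (F (r1 n)) z"] by (simp add: o_def)
    then show ?thesis using lim2[OF z] LIMSEQ_unique by blast
  qed
  have f1: "cmod (f z) \<le> 1/2" if z: "z \<in> D" for z
    by (rule tendsto_upperbound[OF tendsto_norm[OF lim1[OF z]]]) (use FH z in \<open>auto simp: \<H>_def\<close>)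
  have alt: "(\<forall>z\<in>D. deriv f z \<noteq> 0) \<or> (\<forall>z\<in>D. deriv f z = 0)"
  proof (rule disjCI)
    assume "\<not> (\<forall>z\<in>D. deriv f z = 0)"
    then obtain z0 where z0: "z0 \<in> D" "h z0 \<noteq> 0" using heq by auto
    show "\<forall>z\<in>D. deriv f z \<noteq> 0"
    proof (cases "h constant_on D")
      case True
      then show ?thesis using z0 heq by (auto simp: constant_on_def)
    next
      case False
      have "\<forall>\<^sub>F n in sequentially. deriv (F (r1 (r2 n))) z0 \<noteq> 0"
        using lim2[OF z0(1)] z0(2) by (rule tendsto_imp_eventually_ne)
      then obtain N where N: "\<And>n. n \<ge> N \<Longrightarrow> deriv (F (r1 (r2 n))) z0 \<noteq> 0"
        by (auto simp: eventually_sequentially)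
      have nz: "deriv (F (r1 (r2 (n + N)))) z \<noteq> 0" if "z \<in> D" for n z
        using F[of "r1 (r2 (n + N))"] N[of "n + N"] z0(1) that unfolding liouville_family_def D_def by auto
      have ulK: "uniform_limit K (\<lambda>n. deriv (F (r1 (r2 (n + N))))) h sequentially" if K: "compact K" "K \<subseteq> D" for K
        using filterlim_compose[OF ul2[OF K] filterlim_add_const_nat_at_top[of N]] by (simp add: o_def)
      have "h z \<noteq> 0" if z: "z \<in> D" for z
      proof (rule Hurwitz_no_zeros[OF D _ h ulK False nz z])
        show "deriv (F (r1 (r2 (n + N)))) holomorphic_on D" for n
          using FH D by (auto simp: \<H>_def intro: holomorphic_deriv)
      qed
      then show ?thesis using heq by auto
    qed
  qed
  show thesis
  proof (rule that[OF _ r])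
    show "f \<in> liouville_family (ball a R)"
      using f f1 alt by (auto simp: liouville_family_def D_def)
    show "(\<lambda>n. liouville_density (F (r n)) z) \<longlonglongrightarrow> liouville_density f z" if "z \<in> ball a R" for z
    proof -
      have z: "z \<in> D" using that by (simp add: D_def)
      have "3/4 \<le> 1 - (cmod (f z))\<^sup>2" using f1[OF z] by (rule half_disc_gap)
      then have "1 - (cmod (f z))\<^sup>2 \<noteq> 0" by simp
      moreover have "(\<lambda>n. F (r n) z) \<longlonglongrightarrow> f z"
        using LIMSEQ_subseq_LIMSEQ[OF lim1[OF z] r2] by (simp add: r_def o_def)
      moreover have "(\<lambda>n. deriv (F (r n)) z) \<longlonglongrightarrow> deriv f z"
        using lim2[OF z] heq[OF z] by (simp add: r_def)
      ultimately show ?thesis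
        unfolding liouville_density_def by (intro tendsto_intros)
    qed
  qed
qed

section \<open>Smoothness of Liouville densities\<close>

text \<open>
  Derivatives are unique, so the local ones are restrictions of globally chosen ones.
\<close>

lemma C2_on_local:
  fixes f :: "'a::real_normed_vector \<Rightarrow> 'b::real_normed_vector"
  assumes loc: "\<And>x. x \<in> S \<Longrightarrow> \<exists>U. open U \<and> x \<in> U \<and> C2_on U f"
  shows "C2_on S f"
proof -
  define f' where "f' x = (SOME D. (f has_derivative blinfun_apply D) (at x))" for x
  define f'' where "f'' x = (SOME D. (f' has_derivative blinfun_apply D) (at x))" for x
  have f': "f' x = D" if "(f has_derivative blinfun_apply D) (at x)" for x and D :: "'a \<Rightarrow>\<^sub>L 'b"
  proof -
    have "(f has_derivative blinfun_apply (f' x)) (at x)"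
      unfolding f'_def using that by (rule someI)
    then show ?thesis
      using has_derivative_unique[OF _ that] blinfun_apply_inject by blast
  qed
  have f'': "f'' x = D" if "(f' has_derivative blinfun_apply D) (at x)" for x and D :: "'a \<Rightarrow>\<^sub>L 'a \<Rightarrow>\<^sub>L 'b"
  proof -
    have "(f' has_derivative blinfun_apply (f'' x)) (at x)"
      unfolding f''_def using that by (rule someI)
    then show ?thesis
      using has_derivative_unique[OF _ that] blinfun_apply_inject by blast
  qed
  have main: "(f has_derivative blinfun_apply (f' x)) (at x) \<and>
      (f' has_derivative blinfun_apply (f'' x)) (at x) \<and> isCont f'' x" if x: "x \<in> S" for x
  proof -
    obtain U g' g'' where U: "open U" "x \<in> U"
      and g': "\<And>y. y \<in> U \<Longrightarrow> (f has_derivative blinfun_apply (g' y)) (at y)"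
      and g'': "\<And>y. y \<in> U \<Longrightarrow> (g' has_derivative blinfun_apply (g'' y)) (at y)"
      and cont: "continuous_on U g''"
      using loc[OF x] unfolding C2_on_def by blast
    have e1: "f' y = g' y" if "y \<in> U" for y by (rule f'[OF g'[OF that]])
    have d2: "(f' has_derivative blinfun_apply (g'' y)) (at y)" if "y \<in> U" for y
      by (rule has_derivative_transform_within_open[OF g''[OF that] U(1) that]) (simp add: e1)
    have e2: "f'' y = g'' y" if "y \<in> U" for y by (rule f''[OF d2[OF that]])
    have "continuous_on U f''" using cont e2 by (simp cong: continuous_on_cong)
    then have "isCont f'' x" using U by (simp add: continuous_on_eq_continuous_at)
    then show ?thesis using g'[OF U(2)] d2[OF U(2)] e1[OF U(2)] e2[OF U(2)] by simp
  qed
  then have "continuous_on S f''" by (intro continuous_at_imp_continuous_on) blast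
  then show ?thesis unfolding C2_on_def using main by blast
qed

lemma C2_on_cong_open:
  assumes "open S" "C2_on S f" "\<And>x. x \<in> S \<Longrightarrow> f x = g x"
  shows "C2_on S g"
proof -
  obtain f' f'' where *: "\<And>x. x \<in> S \<Longrightarrow> (f has_derivative blinfun_apply (f' x)) (at x)"
    "\<forall>x\<in>S. (f' has_derivative blinfun_apply (f'' x)) (at x)" "continuous_on S f''"
    using assms(2) unfolding C2_on_def by blast
  have "(g has_derivative blinfun_apply (f' x)) (at x)" if "x \<in> S" for x
    by (rule has_derivative_transform_within_open[OF *(1)[OF that] assms(1) that]) (rule assms(3))
  then show ?thesis unfolding C2_on_def using *(2,3) by blast
qed

text \<open>
  Real continuous differentiability in terms of the Wirtinger derivatives \<open>P\<close> and \<open>Q\<close>. In this form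
  the class is visibly closed under algebraic operations and conjugation.
\<close>

definition C1_wirtinger :: "complex set \<Rightarrow> (complex \<Rightarrow> complex) \<Rightarrow> bool" where
  "C1_wirtinger S f \<longleftrightarrow> (\<exists>P Q. continuous_on S P \<and> continuous_on S Q \<and>
     (\<forall>z\<in>S. (f has_derivative (\<lambda>h. P z * h + Q z * cnj h)) (at z)))"

lemma C1_wirtinger_continuous: "C1_wirtinger S f \<Longrightarrow> continuous_on S f"
  unfolding C1_wirtinger_def
  by (meson continuous_at_imp_continuous_on has_derivative_continuous)

lemma C1_wirtinger_holomorphic:
  assumes "open S" "f holomorphic_on S"
  shows "C1_wirtinger S f"
  unfolding C1_wirtinger_def
proof (intro exI conjI ballI)
  show "continuous_on S (deriv f)"
    using assms by (intro holomorphic_on_imp_continuous_on holomorphic_deriv)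
  show "continuous_on S (\<lambda>_. 0)" by (rule continuous_on_const)
  show "(f has_derivative (\<lambda>h. deriv f z * h + 0 * cnj h)) (at z)" if "z \<in> S" for z
    using holomorphic_derivI[OF assms(2,1) that] by (simp add: has_field_derivative_def)
qed

lemma C1_wirtinger_add:
  assumes "C1_wirtinger S f" "C1_wirtinger S g"
  shows "C1_wirtinger S (\<lambda>z. f z + g z)"
proof -
  obtain P Q P' Q' where *: "continuous_on S P" "continuous_on S Q" "continuous_on S P'" "continuous_on S Q'"
    "\<And>z. z \<in> S \<Longrightarrow> (f has_derivative (\<lambda>h. P z * h + Q z * cnj h)) (at z)"
    "\<And>z. z \<in> S \<Longrightarrow> (g has_derivative (\<lambda>h. P' z * h + Q' z * cnj h)) (at z)"
    using assms unfolding C1_wirtinger_def by blast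
  have "((\<lambda>z. f z + g z) has_derivative (\<lambda>h. (P z + P' z) * h + (Q z + Q' z) * cnj h)) (at z)" if "z \<in> S" for z
    by (rule has_derivative_eq_rhs[OF has_derivative_add[OF *(5,6)[OF that]]]) (simp add: fun_eq_iff algebra_simps)
  moreover have "continuous_on S (\<lambda>z. P z + P' z)" "continuous_on S (\<lambda>z. Q z + Q' z)"
    using * by (auto intro!: continuous_intros)
  ultimately show ?thesis
    unfolding C1_wirtinger_def by (intro exI[of _ "\<lambda>z. P z + P' z"] exI[of _ "\<lambda>z. Q z + Q' z"]) auto
qed

lemma C1_wirtinger_mult:
  assumes "C1_wirtinger S f" "C1_wirtinger S g"
  shows "C1_wirtinger S (\<lambda>z. f z * g z)"
proof -
  obtain P Q P' Q' where *: "continuous_on S P" "continuous_on S Q" "continuous_on S P'" "continuous_on S Q'"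
    "\<And>z. z \<in> S \<Longrightarrow> (f has_derivative (\<lambda>h. P z * h + Q z * cnj h)) (at z)"
    "\<And>z. z \<in> S \<Longrightarrow> (g has_derivative (\<lambda>h. P' z * h + Q' z * cnj h)) (at z)"
    using assms unfolding C1_wirtinger_def by blast
  have "((\<lambda>z. f z * g z) has_derivative
      (\<lambda>h. (f z * P' z + P z * g z) * h + (f z * Q' z + Q z * g z) * cnj h)) (at z)" if "z \<in> S" for z
    by (rule has_derivative_eq_rhs[OF has_derivative_mult[OF *(5,6)[OF that]]]) (simp add: fun_eq_iff algebra_simps)
  moreover have "continuous_on S (\<lambda>z. f z * P' z + P z * g z)" "continuous_on S (\<lambda>z. f z * Q' z + Q z * g z)"
    using * assms[THEN C1_wirtinger_continuous] by (auto intro!: continuous_intros)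
  ultimately show ?thesis
    unfolding C1_wirtinger_def
    by (intro exI[of _ "\<lambda>z. f z * P' z + P z * g z"] exI[of _ "\<lambda>z. f z * Q' z + Q z * g z"]) auto
qed

lemma C1_wirtinger_cnj:
  assumes "C1_wirtinger S f"
  shows "C1_wirtinger S (\<lambda>z. cnj (f z))"
proof -
  obtain P Q where *: "continuous_on S P" "continuous_on S Q"
    "\<And>z. z \<in> S \<Longrightarrow> (f has_derivative (\<lambda>h. P z * h + Q z * cnj h)) (at z)"
    using assms unfolding C1_wirtinger_def by blast
  have "((\<lambda>z. cnj (f z)) has_derivative (\<lambda>h. cnj (Q z) * h + cnj (P z) * cnj h)) (at z)" if "z \<in> S" for z
    by (rule has_derivative_eq_rhs[OF bounded_linear.has_derivative[OF bounded_linear_cnj *(3)[OF that]]])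
      (simp add: fun_eq_iff algebra_simps)
  moreover have "continuous_on S (\<lambda>z. cnj (Q z))" "continuous_on S (\<lambda>z. cnj (P z))"
    using * by (auto intro!: continuous_intros)
  ultimately show ?thesis
    unfolding C1_wirtinger_def by (intro exI[of _ "\<lambda>z. cnj (Q z)"] exI[of _ "\<lambda>z. cnj (P z)"]) auto
qed

lemma C1_wirtinger_inverse:
  assumes "C1_wirtinger S f" and nz: "\<And>z. z \<in> S \<Longrightarrow> f z \<noteq> 0"
  shows "C1_wirtinger S (\<lambda>z. inverse (f z))"
proof -
  obtain P Q where *: "continuous_on S P" "continuous_on S Q"
    "\<And>z. z \<in> S \<Longrightarrow> (f has_derivative (\<lambda>h. P z * h + Q z * cnj h)) (at z)"
    using assms unfolding C1_wirtinger_def by blast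
  define k where "k z = - (inverse (f z) * inverse (f z))" for z
  have "((\<lambda>z. inverse (f z)) has_derivative (\<lambda>h. k z * P z * h + k z * Q z * cnj h)) (at z)" if "z \<in> S" for z
    by (rule has_derivative_eq_rhs[OF Deriv.has_derivative_inverse[OF nz[OF that] *(3)[OF that]]])
      (simp add: fun_eq_iff algebra_simps k_def)
  moreover have "continuous_on S k"
    unfolding k_def using nz C1_wirtinger_continuous[OF assms(1)] by (auto intro!: continuous_intros)
  then have "continuous_on S (\<lambda>z. k z * P z)" "continuous_on S (\<lambda>z. k z * Q z)"
    using * by (auto intro!: continuous_intros)
  ultimately show ?thesis
    unfolding C1_wirtinger_def by (intro exI[of _ "\<lambda>z. k z * P z"] exI[of _ "\<lambda>z. k z * Q z"]) auto
qed

lemma C1_wirtinger_of_real: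
  assumes w: "\<And>z. z \<in> S \<Longrightarrow> (w has_derivative (\<lambda>h. Re (A z * h))) (at z)" and A: "continuous_on S A"
  shows "C1_wirtinger S (\<lambda>z. complex_of_real (w z))"
proof -
  have "((\<lambda>z. complex_of_real (w z)) has_derivative (\<lambda>h. A z / 2 * h + cnj (A z) / 2 * cnj h)) (at z)"
    if "z \<in> S" for z
  proof (rule has_derivative_eq_rhs[OF bounded_linear.has_derivative[OF bounded_linear_of_real w[OF that]]])
    have "complex_of_real (Re (A z * h)) = A z / 2 * h + cnj (A z) / 2 * cnj h" for h
      by (simp add: complex_eq_iff field_simps)
    then show "(\<lambda>h. complex_of_real (Re (A z * h))) = (\<lambda>h. A z / 2 * h + cnj (A z) / 2 * cnj h)" by blast
  qed
  moreover have "continuous_on S (\<lambda>z. A z / 2)" "continuous_on S (\<lambda>z. cnj (A z) / 2)"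
    using A by (auto intro!: continuous_intros)
  ultimately show ?thesis
    unfolding C1_wirtinger_def by (intro exI[of _ "\<lambda>z. A z / 2"] exI[of _ "\<lambda>z. cnj (A z) / 2"]) auto
qed

text \<open>
  Every real-linear functional on the plane is \<open>h \<mapsto> Re (a * h)\<close>, so the first derivative of a
  real function is encoded by the complex function \<open>A\<close>, and the second derivative by that of \<open>A\<close>.
\<close>

lemma C2_on_of_C1_wirtinger:
  assumes w: "\<And>z. z \<in> S \<Longrightarrow> (w has_derivative (\<lambda>h. Re (A z * h))) (at z)" and A: "C1_wirtinger S A"
  shows "C2_on S w"
proof -
  obtain P Q where PQ: "continuous_on S P" "continuous_on S Q"
    "\<And>z. z \<in> S \<Longrightarrow> (A has_derivative (\<lambda>h. P z * h + Q z * cnj h)) (at z)"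
    using A unfolding C1_wirtinger_def by blast
  define re where "re = Blinfun Re"
  define cj where "cj = Blinfun cnj"
  have re: "blinfun_apply re = Re" and cj: "blinfun_apply cj = cnj"
    by (simp_all add: re_def cj_def bounded_linear_Blinfun_apply bounded_linear_Re bounded_linear_cnj)
  define L where "L a = re o\<^sub>L blinfun_mult_right a" for a
  have L: "bounded_linear L"
    unfolding L_def
    by (rule bounded_linear_compose[OF bounded_bilinear.bounded_linear_right[OF bounded_bilinear_blinfun_compose] bounded_linear_blinfun_mult_right])
  define LL where "LL = Blinfun L"
  have LL: "blinfun_apply LL = L" by (simp add: LL_def bounded_linear_Blinfun_apply L)
  define w'' where "w'' z = LL o\<^sub>L (blinfun_mult_right (P z) + (blinfun_mult_right (Q z) o\<^sub>L cj))" for z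
  have "(w has_derivative blinfun_apply (L (A z))) (at z)" if "z \<in> S" for z
    by (rule has_derivative_eq_rhs[OF w[OF that]]) (simp add: fun_eq_iff L_def re)
  moreover have "((\<lambda>z. L (A z)) has_derivative blinfun_apply (w'' z)) (at z)" if "z \<in> S" for z
    by (rule has_derivative_eq_rhs[OF bounded_linear.has_derivative[OF L PQ(3)[OF that]]])
      (simp add: fun_eq_iff w''_def LL cj blinfun.add_left)
  moreover have "continuous_on S w''"
    unfolding w''_def
    by (intro continuous_intros bounded_linear.continuous_on[OF bounded_linear_blinfun_mult_right] PQ)
  ultimately show ?thesis
    unfolding C2_on_def by (intro exI[of _ "\<lambda>z. L (A z)"] exI[of _ w'']) auto
qed

lemma has_derivative_cmod_holomorphic:
  assumes "(g has_field_derivative g') (at z)" "g z \<noteq> 0"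
  shows "((\<lambda>z. cmod (g z)) has_derivative (\<lambda>h. Re (of_real (cmod (g z)) * g' / g z * h))) (at z)"
proof -
  have "((\<lambda>z. cmod (g z)) has_derivative (\<lambda>h. (g' * h) \<bullet> sgn (g z))) (at z)"
    using has_derivative_compose[of g "\<lambda>h. g' * h" z UNIV cmod "\<lambda>h. h \<bullet> sgn (g z)"]
      has_derivative_norm[OF assms(2)] assms(1)
    by (simp add: has_field_derivative_def)
  moreover have "(g' * h) \<bullet> sgn (g z) = Re (of_real (cmod (g z)) * g' / g z * h)" for h
  proof -
    have "complex_of_real (cmod (g z)) / g z = cnj (g z) / of_real (cmod (g z))"
      using assms(2) complex_norm_square[of "g z"] by (simp add: field_simps power2_eq_square)
    then have "of_real (cmod (g z)) * g' / g z * h = g' * h * cnj (sgn (g z))"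
      by (simp add: sgn_div_norm scaleR_conv_of_real field_simps) (simp add: divide_inverse mult_ac)
    moreover have "(g' * h) \<bullet> sgn (g z) = Re (g' * h * cnj (sgn (g z)))"
      by (simp add: inner_complex_def)
    ultimately show ?thesis by simp
  qed
  ultimately show ?thesis by simp
qed

text \<open>
  Logarithmic differentiation of \<open>2 |F'| / (1 - |F|^2)\<close> gives \<open>A = w * B\<close> with
  \<open>B = F'' / F' + 2 cnj F * F' / (1 - |F|^2)\<close>.
\<close>

lemma C2_on_liouville_density:
  assumes S: "open S" and F: "F holomorphic_on S" and F1: "\<And>z. z \<in> S \<Longrightarrow> cmod (F z) < 1"
    and nz: "\<And>z. z \<in> S \<Longrightarrow> deriv F z \<noteq> 0"
  shows "C2_on S (liouville_density F)"
proof -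
  define g where "g = deriv F"
  define w where "w = liouville_density F"
  define B where "B z = deriv g z * inverse (g z) + 2 * cnj (F z) * g z * inverse (1 + (-1) * (F z * cnj (F z)))" for z
  have g: "g holomorphic_on S" using F S by (simp add: g_def holomorphic_deriv)
  have g': "deriv g holomorphic_on S" using g S by (simp add: holomorphic_deriv)
  have pos: "0 < 1 - (cmod (F z))\<^sup>2" if "z \<in> S" for z
    using F1[OF that] by (simp add: power_less_one_iff)
  have den: "1 + (-1) * (F z * cnj (F z)) = of_real (1 - (cmod (F z))\<^sup>2)" for z
    using complex_norm_square[of "F z"] by simp
  have dw: "(w has_derivative (\<lambda>h. Re (of_real (w z) * B z * h))) (at z)" if z: "z \<in> S" for z
  proof -
    define N where "N = cmod (g z)"
    define E where "E = 1 - (cmod (F z))\<^sup>2"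
    have E: "E > 0" using pos[OF z] by (simp add: E_def)
    have gz: "g z \<noteq> 0" using nz[OF z] by (simp add: g_def)
    have dF: "(F has_derivative (\<lambda>h. g z * h)) (at z)"
      using holomorphic_derivI[OF F S z] by (simp add: g_def has_field_derivative_def)
    have dN: "((\<lambda>z. cmod (g z)) has_derivative (\<lambda>h. Re (of_real N * deriv g z / g z * h))) (at z)"
      unfolding N_def by (rule has_derivative_cmod_holomorphic[OF holomorphic_derivI[OF g S z] gz])
    have "((\<lambda>z. F z \<bullet> F z) has_derivative (\<lambda>h. F z \<bullet> (g z * h) + (g z * h) \<bullet> F z)) (at z)"
      by (rule has_derivative_inner[OF dF dF])
    moreover have "F z \<bullet> (g z * h) + (g z * h) \<bullet> F z = Re (2 * cnj (F z) * g z * h)" for h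
      by (simp add: inner_complex_def algebra_simps)
    ultimately have "((\<lambda>z. (cmod (F z))\<^sup>2) has_derivative (\<lambda>h. Re (2 * cnj (F z) * g z * h))) (at z)"
      by (simp add: power2_norm_eq_inner)
    then have dE: "((\<lambda>z. 1 - (cmod (F z))\<^sup>2) has_derivative (\<lambda>h. 0 - Re (2 * cnj (F z) * g z * h))) (at z)"
      by (intro has_derivative_diff has_derivative_const)
    have d2N: "((\<lambda>z. 2 * cmod (g z)) has_derivative (\<lambda>h. 2 * Re (of_real N * deriv g z / g z * h))) (at z)"
      by (rule has_derivative_mult_right[OF dN])
    have weq: "w = (\<lambda>z. 2 * cmod (g z) / (1 - (cmod (F z))\<^sup>2))"
      by (simp add: w_def g_def liouville_density_def fun_eq_iff)
    have wz: "w z = 2 * N / E" by (simp add: weq N_def E_def)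
    have Bz: "B z = deriv g z / g z + 2 * cnj (F z) * g z / of_real E"
      unfolding B_def den E_def by (simp add: divide_inverse)
    show ?thesis
      unfolding weq
    proof (rule has_derivative_eq_rhs[OF has_derivative_divide'[OF d2N dE]])
      show "1 - (cmod (F z))\<^sup>2 \<noteq> 0" using E by (simp add: E_def)
      have "(2 * Re (of_real N * deriv g z / g z * h) * E - 2 * N * (0 - Re (2 * cnj (F z) * g z * h))) / (E * E)
          = Re (of_real (2 * N / E) * B z * h)" for h
      proof -
        have "Re (of_real (2 * N / E) * B z * h) = 2 * N / E * Re (B z * h)"
          by (simp add: mult.assoc)
        also have "Re (B z * h) = Re (deriv g z / g z * h) + Re (2 * cnj (F z) * g z * h) / E"
          unfolding Bz distrib_right by simp
        finally have "Re (of_real (2 * N / E) * B z * h) =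
            2 * N / E * (Re (deriv g z / g z * h) + Re (2 * cnj (F z) * g z * h) / E)" .
        moreover have "(2 * (N * x) * E - 2 * N * (0 - y)) / (E * E) = 2 * N / E * (x + y / E)" for x y
          using E by (simp add: field_simps)
        moreover have "of_real N * deriv g z / g z * h = of_real N * (deriv g z / g z * h)"
          by simp
        moreover have "Re (of_real N * c) = N * Re c" for c
          by simp
        ultimately show ?thesis by (simp only:)
      qed
      then show "(\<lambda>h. (2 * Re (of_real N * deriv g z / g z * h) * (1 - (cmod (F z))\<^sup>2)
          - 2 * cmod (g z) * (0 - Re (2 * cnj (F z) * g z * h))) / ((1 - (cmod (F z))\<^sup>2) * (1 - (cmod (F z))\<^sup>2)))
          = (\<lambda>h. Re (of_real (2 * cmod (g z) / (1 - (cmod (F z))\<^sup>2)) * B z * h))"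
        unfolding E_def N_def by blast
    qed
  qed
  have cB: "C1_wirtinger S B"
    unfolding B_def
  proof (intro C1_wirtinger_add C1_wirtinger_mult C1_wirtinger_inverse C1_wirtinger_cnj)
    show "1 + (-1) * (F z * cnj (F z)) \<noteq> 0" if "z \<in> S" for z
      unfolding den using pos[OF that] by (metis less_irrefl of_real_eq_0_iff)
  qed (use nz g_def F g g' S in \<open>auto intro: C1_wirtinger_holomorphic\<close>)
  have "continuous_on S w"
    by (intro continuous_at_imp_continuous_on ballI has_derivative_continuous[OF dw])
  then have "continuous_on S (\<lambda>z. of_real (w z) * B z)"
    using C1_wirtinger_continuous[OF cB] by (intro continuous_intros)
  then have "C1_wirtinger S (\<lambda>z. of_real (w z) * B z)"
    by (intro C1_wirtinger_mult C1_wirtinger_of_real[OF dw] cB)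
  then show ?thesis
    using C2_on_of_C1_wirtinger[OF dw] by (simp add: w_def)
qed

section \<open>Perron's method\<close>

lemma SK_metric_continuous: "SK_metric G l \<Longrightarrow> continuous_on G l"
  and SK_metric_nonneg: "SK_metric G l \<Longrightarrow> z \<in> G \<Longrightarrow> 0 \<le> l z"
  and SK_metric_nonzero: "SK_metric G l \<Longrightarrow> \<exists>z\<in>G. l z > 0"
  by (auto simp: SK_metric_def conformal_pseudo_metric_def order.strict_iff_order)

text \<open>
  To extend the SK-property from \<open>l\<close> to a larger \<open>m\<close> it is enough to treat each point separately: either
  the differential inequality is known there or some SK-metric touches \<open>m\<close> from below.
\<close>

lemma SK_metric_by_touching:
  assumes G: "open G" and l: "SK_metric G l" and m: "continuous_on G m"
    and le: "\<And>z. z \<in> G \<Longrightarrow> l z \<le> m z"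
    and touch: "\<And>z. z \<in> G \<Longrightarrow> m z > 0 \<Longrightarrow> log_subsolution_at m z \<or> (\<exists>k. SK_metric G k \<and> (\<forall>w\<in>G. k w \<le> m w) \<and> k z = m z)"
  shows "SK_metric G m"
  unfolding SK_metric_iff conformal_pseudo_metric_def
proof (intro conjI ballI impI)
  show "0 \<le> m z" if "z \<in> G" for z
    using le[OF that] SK_metric_nonneg[OF l that] by linarith
  show "\<exists>z\<in>G. m z \<noteq> 0"
    using SK_metric_nonzero[OF l] le by (metis not_less_iff_gr_or_eq order_less_le_trans)
  show "log_subsolution_at m z" if z: "z \<in> G" "m z > 0" for z
    using touch[OF z]
  proof
    assume "\<exists>k. SK_metric G k \<and> (\<forall>w\<in>G. k w \<le> m w) \<and> k z = m z"
    then obtain k where k: "SK_metric G k" "\<And>w. w \<in> G \<Longrightarrow> k w \<le> m w" "k z = m z" by blast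
    show ?thesis
    proof (rule log_subsolution_at_touching[OF G z(1) SK_metric_continuous[OF k(1)] m k(2)])
      show "log_subsolution_at k z" using k(1,3) z by (auto simp: SK_metric_iff)
    qed (use k(3) z in auto)
  qed
qed (rule m)

lemma SK_metric_max:
  assumes G: "open G" and l: "SK_metric G l" and m: "SK_metric G m"
  shows "SK_metric G (\<lambda>z. max (l z) (m z))"
proof (rule SK_metric_by_touching[OF G l])
  show "continuous_on G (\<lambda>z. max (l z) (m z))"
    by (intro continuous_intros SK_metric_continuous l m)
  show "log_subsolution_at (\<lambda>z. max (l z) (m z)) z \<or>
      (\<exists>k. SK_metric G k \<and> (\<forall>w\<in>G. k w \<le> max (l w) (m w)) \<and> k z = max (l z) (m z))" for z
    using l m by (cases "l z \<le> m z") (auto simp: max_def)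
qed auto

text \<open>
  Ahlfors' lemma on a disc of radius \<open>s\<close>, used on the concentric disc of radius \<open>s / 64\<close>. The bound
  \<open>1/16\<close> leaves room for the perturbation of boundary values in \<open>SK_metric_modification\<close>.
\<close>

lemma SK_metrics_locally_bounded:
  assumes G: "open G" "a \<in> G"
  shows "\<exists>R>0. cball a R \<subseteq> G \<and> (\<forall>l z. SK_metric G l \<longrightarrow> z \<in> cball a R \<longrightarrow> R * l z \<le> 1/16)"
proof -
  obtain s where s: "s > 0" "cball a s \<subseteq> G" using G open_contains_cball by blast
  define R where "R = s / 64"
  have R: "R > 0" "cball a R \<subseteq> G" using s by (auto simp: R_def)
  moreover have "R * l z \<le> 1/16" if l: "SK_metric G l" and z: "z \<in> cball a R" for l z
  proof -
    have zs: "z \<in> cball a s" and zG: "z \<in> G" using z s R by (auto simp: R_def)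
    have "(cmod (z - a))\<^sup>2 \<le> (s / 64)\<^sup>2"
      using z by (intro power_mono) (auto simp: R_def dist_norm norm_minus_commute)
    also have "\<dots> \<le> s\<^sup>2 / 2" by (simp add: power_divide)
    finally have "s\<^sup>2 / 2 \<le> s\<^sup>2 - (cmod (z - a))\<^sup>2" by simp
    then have "l z * (s\<^sup>2 / 2) \<le> l z * (s\<^sup>2 - (cmod (z - a))\<^sup>2)"
      by (intro mult_left_mono SK_metric_nonneg[OF l zG])
    also have "\<dots> \<le> 2 * s"
    proof (rule ahlfors_lemma[OF s(1) _ _ zs])
      show "continuous_on (cball a s) l"
        using SK_metric_continuous[OF l] s(2) by (rule continuous_on_subset)
      show "log_subsolution_at l y" if "y \<in> ball a s" "l y > 0" for y
      proof -
        have "y \<in> G" using that(1) s(2) ball_subset_cball[of a s] by blast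
        then show ?thesis using l that(2) by (simp add: SK_metric_iff)
      qed
    qed
    finally have "s * (s * l z) \<le> s * 4" by (simp add: power2_eq_square mult_ac)
    then have "s * l z \<le> 4" using s(1) by simp
    then show ?thesis by (simp add: R_def)
  qed
  ultimately show ?thesis by blast
qed

lemma liouville_density_continuous:
  assumes "open D" "F \<in> liouville_family D"
  shows "continuous_on D (liouville_density F)"
proof -
  have F: "F holomorphic_on D" "\<And>z. z \<in> D \<Longrightarrow> cmod (F z) \<le> 1/2"
    using assms(2) by (auto simp: liouville_family_def)
  have "1 - (cmod (F z))\<^sup>2 \<noteq> 0" if "z \<in> D" for z
  proof -
    have "3/4 \<le> 1 - (cmod (F z))\<^sup>2" using F(2)[OF that] by (rule half_disc_gap)
    then show ?thesis by simp
  qed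
  then show ?thesis
    unfolding liouville_density_def[abs_def] using F(1) assms(1)
    by (intro continuous_intros holomorphic_on_imp_continuous_on holomorphic_deriv) auto
qed

text \<open>
  Solve the Dirichlet problem on the disc with boundary values \<open>l\<close> and replace \<open>l\<close> by the solution
  inside. As \<open>l\<close> may have zeros on the circle, positive boundary values
  \<open>l + \<epsilon> n\<close> are used first. The solutions \<open>w n\<close> decrease with \<open>n\<close> and lie above \<open>l\<close> by comparison, and
  a subsequence converges to a Liouville density squeezed between \<open>l\<close> and every \<open>w n\<close>. This squeeze
  gives continuity across the circle, where the new density is touched from below by \<open>l\<close>.
\<close>

lemma SK_metric_modification:
  assumes G: "open G" and l: "SK_metric G l" and R: "R > 0" and sub: "cball a R \<subseteq> G"
    and small: "\<And>z. z \<in> cball a R \<Longrightarrow> R * l z \<le> 1/16"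
  shows "\<exists>m F. SK_metric G m \<and> (\<forall>z\<in>G. l z \<le> m z) \<and> F \<in> liouville_family (ball a R) \<and>
     (\<forall>z\<in>ball a R. m z = liouville_density F z)"
proof -
  have bG: "z \<in> G" if "z \<in> ball a R" for z using sub that by auto
  have lc: "continuous_on G l" by (rule SK_metric_continuous[OF l])
  have lc': "continuous_on (cball a R) l" by (rule continuous_on_subset[OF lc sub])
  define \<epsilon> where "\<epsilon> n = inverse (real (Suc n)) / (16 * R)" for n
  have \<epsilon>: "\<epsilon> n > 0" for n using R by (simp add: \<epsilon>_def)
  have \<epsilon>_mono: "\<epsilon> k \<le> \<epsilon> n" if "n \<le> k" for n k
    unfolding \<epsilon>_def using R that by (intro divide_right_mono le_imp_inverse_le) auto
  have "\<exists>F w. solves_liouville_dirichlet a R (\<lambda>z. l z + \<epsilon> n) F w" for n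
  proof (rule liouville_dirichlet[OF R])
    show "continuous_on (sphere a R) (\<lambda>z. l z + \<epsilon> n)"
      by (intro continuous_intros continuous_on_subset[OF lc']) auto
    show "0 < l z + \<epsilon> n" if "z \<in> sphere a R" for z
      using SK_metric_nonneg[OF l, of z] \<epsilon>[of n] sub that by force
    show "R * (l z + \<epsilon> n) \<le> 1/8" if "z \<in> sphere a R" for z
    proof -
      have "R * \<epsilon> n = inverse (real (Suc n)) / 16" using R by (simp add: \<epsilon>_def)
      also have "\<dots> \<le> 1 / 16" by (intro divide_right_mono) (auto simp: inverse_le_1_iff)
      finally show ?thesis using small[of z] that by (simp add: distrib_left)
    qed
  qed
  then obtain F w where sol: "\<And>n. solves_liouville_dirichlet a R (\<lambda>z. l z + \<epsilon> n) (F n) (w n)"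
    by metis
  have Fh: "F n holomorphic_on ball a R" and F1: "\<And>z. z \<in> ball a R \<Longrightarrow> cmod (F n z) \<le> 1/2"
    and F': "\<And>z. z \<in> ball a R \<Longrightarrow> deriv (F n) z \<noteq> 0"
    and wc: "continuous_on (cball a R) (w n)" and wpos: "\<And>z. z \<in> cball a R \<Longrightarrow> 0 < w n z"
    and wF: "\<And>z. z \<in> ball a R \<Longrightarrow> w n z = liouville_density (F n) z"
    and ws: "\<And>z. z \<in> sphere a R \<Longrightarrow> w n z = l z + \<epsilon> n" for n
    using sol[of n] unfolding solves_liouville_dirichlet_def by blast+
  have lap: "lower_laplacian (\<lambda>y. ln (w n y)) z = ereal ((w n z)\<^sup>2)" if z: "z \<in> ball a R" for n z
  proof (rule lower_laplacian_ln_of_liouville[OF open_ball z Fh _ F'[OF z] wF])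
    show "cmod (F n y) < 1" if "y \<in> ball a R" for y using F1[OF that, of n] by linarith
  qed
  have lw: "l z \<le> w n z" if "z \<in> cball a R" for n z
  proof (rule comparison_on_disc[OF lc' _ wc wpos lap _ that])
    show "log_subsolution_at l y" if "y \<in> ball a R" "l y > 0" for y
      using l that bG by (simp add: SK_metric_iff)
    show "l y \<le> w n y" if "y \<in> sphere a R" for y
      using ws[OF that, of n] \<epsilon>[of n] by simp
  qed
  have ww: "w k z \<le> w n z" if "n \<le> k" "z \<in> cball a R" for n k z
  proof (rule comparison_on_disc[OF wc _ wc wpos lap _ that(2)])
    show "log_subsolution_at (w k) y" if "y \<in> ball a R" for y
      using lap[OF that, of k] by (simp add: log_subsolution_at_def)
    show "w k y \<le> w n y" if "y \<in> sphere a R" for y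
      using ws[OF that] \<epsilon>_mono[OF \<open>n \<le> k\<close>] by simp
  qed
  have fam: "F n \<in> liouville_family (ball a R)" for n
    unfolding liouville_family_def using Fh F1 F' by blast
  obtain f r where f: "f \<in> liouville_family (ball a R)" and r: "strict_mono (r :: nat \<Rightarrow> nat)"
    and lim: "\<And>z. z \<in> ball a R \<Longrightarrow> (\<lambda>n. liouville_density (F (r n)) z) \<longlonglongrightarrow> liouville_density f z"
    using liouville_family_compact[of F a R, OF fam] by blast
  define m where "m z = (if z \<in> ball a R then liouville_density f z else l z)" for z
  have limw: "(\<lambda>n. w (r n) z) \<longlonglongrightarrow> m z" if "z \<in> ball a R" for z
    using lim[OF that] that by (simp add: m_def wF)
  have mw: "m z \<le> w n z" if z: "z \<in> cball a R" for n z
  proof (cases "z \<in> ball a R")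
    case True
    have "w (r k) z \<le> w n z" if "k \<ge> n" for k
      using ww[of n "r k"] strict_mono_imp_increasing[OF r, of k] that z by simp
    then show ?thesis
      by (intro LIMSEQ_le_const2[OF limw[OF True]] exI[of _ n]) auto
  qed (use lw[OF z] in \<open>simp add: m_def\<close>)
  have lm: "l z \<le> m z" if "z \<in> G" for z
  proof (cases "z \<in> ball a R")
    case True
    then show ?thesis
      by (intro LIMSEQ_le_const[OF limw[OF True]] exI[of _ 0]) (use lw in auto)
  qed (simp add: m_def)
  have "isCont m z" if z: "z \<in> G" for z
  proof -
    have lcz: "isCont l z" using lc G z by (simp add: continuous_on_eq_continuous_at)
    consider "z \<in> ball a R" | "z \<in> - cball a R" | "z \<in> sphere a R" by force
    then show ?thesis
    proof cases
      case 1
      have "continuous_on (ball a R) m"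
        by (rule continuous_on_eq[OF liouville_density_continuous[OF open_ball f]]) (simp add: m_def)
      then show ?thesis using 1 by (simp add: continuous_on_eq_continuous_at)
    next
      case 2
      have "continuous_on (G \<inter> - cball a R) m"
        by (rule continuous_on_eq[OF continuous_on_subset[OF lc]]) (auto simp: m_def)
      moreover have "open (G \<inter> - cball a R)" using G by auto
      ultimately show ?thesis using 2 z by (simp add: continuous_on_eq_continuous_at)
    next
      case 3
      have mz: "m z = l z" using 3 by (simp add: m_def)
      show ?thesis
        unfolding continuous_at_eps_delta
      proof (intro allI impI)
        fix e :: real assume e: "e > 0"
        \<comment> \<open>Inside the disc \<open>m\<close> lies between \<open>l\<close> and \<open>w n\<close>, which on the circle differ by \<open>\<epsilon> n\<close> only.\<close>
        have "(\<lambda>n. inverse (real (Suc n)) / (16 * R)) \<longlonglongrightarrow> 0 / (16 * R)"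
          by (intro tendsto_divide LIMSEQ_inverse_real_of_nat tendsto_const) (use R in auto)
        then have "\<forall>\<^sub>F n in sequentially. \<epsilon> n < e / 2"
          unfolding \<epsilon>_def using e by (intro order_tendstoD(2)) auto
        then obtain n where n: "\<epsilon> n < e / 2" by (auto simp: eventually_sequentially)
        obtain d1 where d1: "d1 > 0" "ball z d1 \<subseteq> G" using G z openE by blast
        obtain d2 where d2: "d2 > 0" "\<And>y. dist y z < d2 \<Longrightarrow> dist (l y) (l z) < e"
          using lcz e unfolding continuous_at_eps_delta by blast
        have "z \<in> cball a R" using 3 by auto
        then obtain d3 where d3: "d3 > 0"
          "\<And>y. y \<in> cball a R \<Longrightarrow> dist y z < d3 \<Longrightarrow> dist (w n y) (w n z) < e / 2"
          using wc[of n] e unfolding continuous_on_iff by (meson half_gt_zero)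
        have "dist (m y) (m z) < e" if y: "dist y z < min d1 (min d2 d3)" for y
        proof -
          have yG: "y \<in> G" using y d1(2) by (auto simp: dist_commute)
          have ly: "dist (l y) (l z) < e" using d2(2) y by simp
          show ?thesis
          proof (cases "y \<in> ball a R")
            case True
            then have yc: "y \<in> cball a R" by simp
            have "m y \<le> w n y" by (rule mw[OF yc])
            moreover have "dist (w n y) (w n z) < e / 2" using d3(2)[OF yc] y by simp
            moreover have "w n z = l z + \<epsilon> n" by (rule ws[OF 3])
            moreover have "l y \<le> m y" by (rule lm[OF yG])
            ultimately show ?thesis using ly n mz by (simp add: dist_real_def abs_if split: if_splits)
          qed (use ly mz in \<open>simp add: m_def\<close>)
        qed
        then show "\<exists>d>0. \<forall>y. dist y z < d \<longrightarrow> dist (m y) (m z) < e"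
          using d1(1) d2(1) d3(1) by (intro exI[of _ "min d1 (min d2 d3)"]) auto
      qed
    qed
  qed
  then have mc: "continuous_on G m" by (intro continuous_at_imp_continuous_on) blast
  have "SK_metric G m"
  proof (rule SK_metric_by_touching[OF G l mc lm])
    fix z assume z: "z \<in> G" "m z > 0"
    show "log_subsolution_at m z \<or> (\<exists>k. SK_metric G k \<and> (\<forall>w\<in>G. k w \<le> m w) \<and> k z = m z)"
    proof (cases "z \<in> ball a R")
      case True
      have "lower_laplacian (\<lambda>y. ln (m y)) z = ereal ((m z)\<^sup>2)"
      proof (rule lower_laplacian_ln_of_liouville[OF open_ball True])
        show "f holomorphic_on ball a R" using f by (simp add: liouville_family_def)
        show "cmod (f y) < 1" if "y \<in> ball a R" for y
          using f that by (force simp: liouville_family_def)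
        show "deriv f z \<noteq> 0" using z True by (auto simp: m_def liouville_density_def)
      qed (simp add: m_def)
      then show ?thesis by (simp add: log_subsolution_at_def)
    next
      case False
      then have "l z = m z" by (simp add: m_def)
      then show ?thesis using l lm by blast
    qed
  qed
  then show ?thesis using lm f by (intro exI[of _ m] exI[of _ f]) (auto simp: m_def)
qed

text \<open>
  Choose SK-metrics that approximate the supremum at every point of a countable dense set, make
  the sequence increasing by maxima and modify each member to be a Liouville density on the disc. A
  subsequence converges to a Liouville density \<open>f\<close> that lies below the supremum and equals it on the dense
  set. Any single SK-metric is continuous and lies below \<open>f\<close> on the dense set, hence everywhere; so
  \<open>f\<close> is the supremum.
\<close>

lemma sup_SK_locally_liouville:
  assumes G: "open G" and ne: "SK_metrics G \<noteq> {}" and R: "R > 0" and sub: "cball a R \<subseteq> G"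
    and small: "\<And>l z. SK_metric G l \<Longrightarrow> z \<in> cball a R \<Longrightarrow> R * l z \<le> 1/16"
  shows "\<exists>F \<in> liouville_family (ball a R). \<forall>z\<in>ball a R. sup_SK G z = liouville_density F z"
proof -
  define s where "s = sup_SK G"
  have bG: "z \<in> G" if "z \<in> ball a R" for z using sub that by auto
  have bdd: "bdd_above ((\<lambda>l. l z) ` SK_metrics G)" if "z \<in> ball a R" for z
  proof (rule bdd_aboveI2)
    fix l assume "l \<in> SK_metrics G"
    then show "l z \<le> 1/16 / R"
      using small[of l z] that R by (simp add: SK_metrics_def pos_le_divide_eq mult_ac)
  qed
  have le_s: "l z \<le> s z" if "SK_metric G l" "z \<in> ball a R" for l z
    unfolding s_def sup_SK_def using that by (intro cSUP_upper bdd) (auto simp: SK_metrics_def)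
  obtain Q where Q: "countable Q" "Q \<subseteq> ball a R" "ball a R \<subseteq> closure Q"
    using separable by blast
  have "Q \<noteq> {}" using Q(3) R by auto
  define q where "q = from_nat_into Q"
  have q: "range q = Q" unfolding q_def by (rule range_from_nat_into[OF \<open>Q \<noteq> {}\<close> Q(1)])
  have qb: "q j \<in> ball a R" for j using q Q(2) by blast
  have "\<exists>l. SK_metric G l \<and> l (q j) > s (q j) - inverse (real (Suc k))" for j k
  proof -
    have "s (q j) - inverse (real (Suc k)) < (SUP l\<in>SK_metrics G. l (q j))"
      by (simp add: s_def sup_SK_def)
    then obtain l where "l \<in> SK_metrics G" "s (q j) - inverse (real (Suc k)) < l (q j)"
      using less_cSUP_iff[OF ne bdd[OF qb]] by blast
    then show ?thesis by (auto simp: SK_metrics_def)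
  qed
  then obtain L where L: "\<And>j k. SK_metric G (L j k)" "\<And>j k. L j k (q j) > s (q j) - inverse (real (Suc k))"
    by metis
  \<comment> \<open>A single enumeration of all approximants, one for each point of the dense set and each precision.\<close>
  define \<nu> where "\<nu> n = (case prod_decode n of (j, k) \<Rightarrow> L j k)" for n
  have \<nu>: "SK_metric G (\<nu> n)" for n by (simp add: \<nu>_def L(1) split: prod.split)
  have "\<forall>l. \<exists>m. SK_metric G l \<longrightarrow> SK_metric G m \<and> (\<forall>z\<in>G. l z \<le> m z) \<and>
      (\<exists>F. F \<in> liouville_family (ball a R) \<and> (\<forall>z\<in>ball a R. m z = liouville_density F z))"
    using SK_metric_modification[OF G _ R sub] small by (metis (no_types, lifting))
  then obtain M where M: "\<And>l. SK_metric G l \<Longrightarrow> SK_metric G (M l) \<and> (\<forall>z\<in>G. l z \<le> M l z) \<and>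
      (\<exists>F. F \<in> liouville_family (ball a R) \<and> (\<forall>z\<in>ball a R. M l z = liouville_density F z))"
    by metis
  define \<mu> where "\<mu> = rec_nat (M (\<nu> 0)) (\<lambda>n \<mu>. M (\<lambda>z. max (\<mu> z) (\<nu> (Suc n) z)))"
  have \<mu>0: "\<mu> 0 = M (\<nu> 0)" and \<mu>S: "\<mu> (Suc n) = M (\<lambda>z. max (\<mu> n z) (\<nu> (Suc n) z))" for n
    by (simp_all add: \<mu>_def)
  have SK: "SK_metric G (\<mu> n)" for n
  proof (induction n)
    case 0
    then show ?case using M[OF \<nu>] by (simp add: \<mu>0)
  next
    case (Suc n)
    then show ?case using M[OF SK_metric_max[OF G Suc \<nu>]] by (simp add: \<mu>S)
  qed
  have step: "max (\<mu> n z) (\<nu> (Suc n) z) \<le> \<mu> (Suc n) z" if "z \<in> G" for n z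
    using M[OF SK_metric_max[OF G SK \<nu>, of n "Suc n"]] that unfolding \<mu>S by blast
  have \<mu>_ge: "\<nu> i z \<le> \<mu> n z" if "i \<le> n" "z \<in> G" for i n z
    using that(1)
  proof (induction n)
    case 0
    then show ?case using M[OF \<nu>, of 0] that(2) by (simp add: \<mu>0)
  next
    case (Suc n)
    then show ?case using step[OF that(2), of n] by (cases "i = Suc n") auto
  qed
  have "\<exists>F. F \<in> liouville_family (ball a R) \<and> (\<forall>z\<in>ball a R. \<mu> n z = liouville_density F z)" for n
    using M[OF \<nu>, of 0] M[OF SK_metric_max[OF G SK \<nu>, of "n - 1" n]]
    by (cases n) (auto simp: \<mu>0 \<mu>S)
  then obtain F where F: "\<And>n. F n \<in> liouville_family (ball a R)"
    "\<And>n z. z \<in> ball a R \<Longrightarrow> \<mu> n z = liouville_density (F n) z" by metis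
  obtain f r where f: "f \<in> liouville_family (ball a R)" and r: "strict_mono (r :: nat \<Rightarrow> nat)"
    and lim: "\<And>z. z \<in> ball a R \<Longrightarrow> (\<lambda>n. liouville_density (F (r n)) z) \<longlonglongrightarrow> liouville_density f z"
    using liouville_family_compact[of F a R, OF F(1)] by blast
  have lim\<mu>: "(\<lambda>n. \<mu> (r n) z) \<longlonglongrightarrow> liouville_density f z" if "z \<in> ball a R" for z
    using lim[OF that] by (simp add: F(2)[OF that])
  have f_le: "liouville_density f z \<le> s z" if z: "z \<in> ball a R" for z
    by (rule LIMSEQ_le_const2[OF lim\<mu>[OF z]]) (use le_s[OF SK z] in auto)
  have s_le: "s (q j) \<le> liouville_density f (q j)" for j
  proof -
    have "s (q j) - inverse (real (Suc k)) \<le> liouville_density f (q j)" for k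
    proof (rule LIMSEQ_le_const[OF lim\<mu>[OF qb]])
      have "s (q j) - inverse (real (Suc k)) \<le> \<mu> (r n) (q j)" if "n \<ge> prod_encode (j, k)" for n
      proof -
        have "\<nu> (prod_encode (j, k)) (q j) \<le> \<mu> (r n) (q j)"
          using strict_mono_imp_increasing[OF r, of n] that by (intro \<mu>_ge bG qb) simp
        then show ?thesis using L(2)[of j k] by (simp add: \<nu>_def)
      qed
      then show "\<exists>N. \<forall>n\<ge>N. s (q j) - inverse (real (Suc k)) \<le> \<mu> (r n) (q j)" by blast
    qed
    moreover have "(\<lambda>k. s (q j) - inverse (real (Suc k))) \<longlonglongrightarrow> s (q j) - 0"
      by (intro tendsto_diff tendsto_const LIMSEQ_inverse_real_of_nat)
    ultimately show ?thesis
      by (intro LIMSEQ_le_const2[of "\<lambda>k. s (q j) - inverse (real (Suc k))"]) auto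
  qed
  have s_le': "s b \<le> liouville_density f b" if b: "b \<in> ball a R" for b
    unfolding s_def sup_SK_def
  proof (rule cSUP_least[OF ne])
    fix l assume "l \<in> SK_metrics G"
    then have l: "SK_metric G l" by (simp add: SK_metrics_def)
    obtain x where x: "\<And>n. x n \<in> Q" "x \<longlonglongrightarrow> b"
      using Q(3) b closure_sequential[of b Q] by blast
    have lx: "l (x n) \<le> liouville_density f (x n)" for n
    proof -
      obtain j where "x n = q j" using x(1)[of n] q by (metis rangeE)
      then show ?thesis using s_le[of j] le_s[OF l qb[of j]] by simp
    qed
    have "isCont l b"
      using SK_metric_continuous[OF l] G bG[OF b] by (simp add: continuous_on_eq_continuous_at)
    moreover have "isCont (liouville_density f) b"
      using liouville_density_continuous[OF open_ball f] b by (simp add: continuous_on_eq_continuous_at)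
    ultimately show "l b \<le> liouville_density f b"
      using LIMSEQ_le[OF isCont_tendsto_compose isCont_tendsto_compose, OF _ x(2) _ x(2)] lx by blast
  qed
  show ?thesis
  proof (rule bexI[OF _ f])
    show "\<forall>z\<in>ball a R. sup_SK G z = liouville_density f z"
      using f_le s_le' unfolding s_def by (intro ballI antisym) auto
  qed
qed

theorem theorem4p13:
  fixes G :: "complex set"
  assumes "open G" and "connected G" and "G \<noteq> {}"
    and "SK_metrics G \<noteq> {}"
  shows "(\<forall>z\<in>G. bdd_above ((\<lambda>l. l z) ` SK_metrics G)) \<and>
         conformal_metric G (sup_SK G) \<and>
         regular_pseudo_metric G (sup_SK G) \<and>
         (\<forall>z\<in>G. curvature (sup_SK G) z = -1) \<and>
         maximal_SK_metric G (sup_SK G) \<and>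
         (\<forall>m. maximal_SK_metric G m \<longrightarrow> (\<forall>z\<in>G. m z = sup_SK G z))"
proof -
  note G = assms(1)
  define s where "s = sup_SK G"
  have bdd: "bdd_above ((\<lambda>l. l z) ` SK_metrics G)" if z: "z \<in> G" for z
  proof -
    obtain R where R: "R > 0" "\<And>l. SK_metric G l \<Longrightarrow> R * l z \<le> 1/16"
      using SK_metrics_locally_bounded[OF G z] by (metis centre_in_cball less_imp_le)
    show ?thesis
    proof (rule bdd_aboveI2)
      fix l assume "l \<in> SK_metrics G"
      then show "l z \<le> 1/16 / R"
        using R(2)[of l] R(1) by (simp add: SK_metrics_def pos_le_divide_eq mult_ac)
    qed
  qed
  have le_s: "l z \<le> s z" if "SK_metric G l" "z \<in> G" for l z
    unfolding s_def sup_SK_def using that by (intro cSUP_upper bdd) (auto simp: SK_metrics_def)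
  have loc: "\<exists>R F. R > 0 \<and> ball a R \<subseteq> G \<and> F \<in> liouville_family (ball a R) \<and>
      (\<forall>z\<in>ball a R. s z = liouville_density F z)" if a: "a \<in> G" for a
  proof -
    obtain R where R: "R > 0" "cball a R \<subseteq> G" "\<And>l z. SK_metric G l \<Longrightarrow> z \<in> cball a R \<Longrightarrow> R * l z \<le> 1/16"
      using SK_metrics_locally_bounded[OF G a] by blast
    have "ball a R \<subseteq> G" using R(2) by auto
    moreover have "\<exists>F\<in>liouville_family (ball a R). \<forall>z\<in>ball a R. sup_SK G z = liouville_density F z"
      by (rule sup_SK_locally_liouville[OF G assms(4) R(1,2)]) (rule R(3))
    ultimately show ?thesis
      using R(1) unfolding s_def by blast
  qed
  have sc: "continuous_on G s"
  proof (intro continuous_at_imp_continuous_on ballI)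
    fix a assume "a \<in> G"
    then obtain R F where R: "R > 0" "F \<in> liouville_family (ball a R)" "\<forall>z\<in>ball a R. s z = liouville_density F z"
      using loc by blast
    have "continuous_on (ball a R) s"
      by (rule continuous_on_eq[OF liouville_density_continuous[OF open_ball R(2)]]) (use R(3) in simp)
    then show "isCont s a" using R(1) by (simp add: continuous_on_eq_continuous_at)
  qed
  obtain l0 where l0: "SK_metric G l0" using assms(4) by (auto simp: SK_metrics_def)
  have s_nonneg: "s z \<ge> 0" if "z \<in> G" for z
    using SK_metric_nonneg[OF l0 that] le_s[OF l0 that] by linarith
  have dens_pos: "0 < liouville_density F z \<longleftrightarrow> deriv F z \<noteq> 0"
    if "F \<in> liouville_family D" "z \<in> D" for F D z
  proof -
    have "cmod (F z) \<le> 1/2" using that by (auto simp: liouville_family_def)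
    then have "3/4 \<le> 1 - (cmod (F z))\<^sup>2" by (rule half_disc_gap)
    then have "1 - (cmod (F z))\<^sup>2 > 0" by simp
    then show ?thesis by (simp add: liouville_density_def zero_less_divide_iff)
  qed
  have spos: "s z > 0" if z: "z \<in> G" for z
  proof -
    define U where "U = {z\<in>G. s z > 0}"
    define V where "V = {z\<in>G. s z = 0}"
    \<comment> \<open>Positivity of the supremum is an open and closed condition.\<close>
    have dich: "\<exists>R>0. ball a R \<subseteq> U \<or> ball a R \<subseteq> V" if a: "a \<in> G" for a
    proof -
      obtain R F where R: "R > 0" "ball a R \<subseteq> G" "F \<in> liouville_family (ball a R)"
        "\<And>z. z \<in> ball a R \<Longrightarrow> s z = liouville_density F z"
        using loc[OF a] by blast
      from R(3) consider "\<And>z. z \<in> ball a R \<Longrightarrow> deriv F z \<noteq> 0" | "\<And>z. z \<in> ball a R \<Longrightarrow> deriv F z = 0"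
        unfolding liouville_family_def by blast
      then show ?thesis
      proof cases
        case 1
        have "ball a R \<subseteq> U"
        proof
          fix z assume z: "z \<in> ball a R"
          have "liouville_density F z > 0" using dens_pos[OF R(3) z] 1[OF z] by blast
          then show "z \<in> U" using R(2,4) z by (auto simp: U_def)
        qed
        then show ?thesis using R(1) by blast
      next
        case 2
        have "ball a R \<subseteq> V" using 2 R(2,4) by (auto simp: V_def liouville_density_def)
        then show ?thesis using R(1) by blast
      qed
    qed
    have disj: "U \<inter> V = {}" by (auto simp: U_def V_def)
    have UV: "\<exists>R>0. ball a R \<subseteq> U" if "a \<in> U" for a
    proof -
      have "a \<in> G" using that by (simp add: U_def)
      then obtain R where "R > 0" "ball a R \<subseteq> U \<or> ball a R \<subseteq> V" using dich by blast
      moreover have "\<not> ball a R \<subseteq> V"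
        using that disj centre_in_ball[of a R] \<open>R > 0\<close> by blast
      ultimately show ?thesis by blast
    qed
    have VU: "\<exists>R>0. ball a R \<subseteq> V" if "a \<in> V" for a
    proof -
      have "a \<in> G" using that by (simp add: V_def)
      then obtain R where "R > 0" "ball a R \<subseteq> U \<or> ball a R \<subseteq> V" using dich by blast
      moreover have "\<not> ball a R \<subseteq> U"
        using that disj centre_in_ball[of a R] \<open>R > 0\<close> by blast
      ultimately show ?thesis by blast
    qed
    have "open U" "open V" unfolding open_contains_ball using UV VU by blast+
    moreover have "G \<subseteq> U \<union> V" using s_nonneg by (force simp: U_def V_def)
    ultimately have "U \<inter> G = {} \<or> V \<inter> G = {}"
      using connectedD[OF assms(2)] disj by blast
    moreover obtain y where "y \<in> G" "l0 y > 0" using SK_metric_nonzero[OF l0] by blast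
    then have "y \<in> U \<inter> G" using le_s[OF l0] by (force simp: U_def)
    ultimately have "V \<inter> G = {}" by blast
    then have "s z \<noteq> 0" using z by (auto simp: V_def)
    then show ?thesis using s_nonneg[OF z] by simp
  qed
  have curv: "curvature s z = -1" and sub: "log_subsolution_at s z" and C2: "\<exists>U. open U \<and> z \<in> U \<and> C2_on U s"
    if z: "z \<in> G" for z
  proof -
    obtain R F where R: "R > 0" "ball z R \<subseteq> G" "F \<in> liouville_family (ball z R)"
      "\<And>y. y \<in> ball z R \<Longrightarrow> s y = liouville_density F y"
      using loc[OF z] by blast
    have zb: "z \<in> ball z R" using R(1) by simp
    have nz: "deriv F y \<noteq> 0" if "y \<in> ball z R" for y
      using dens_pos[OF R(3) that] spos[of y] R(2,4) that by auto
    have Fh: "F holomorphic_on ball z R" and F1: "cmod (F y) < 1" if "y \<in> ball z R" for y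
      using R(3) that by (force simp: liouville_family_def)+
    have lap: "lower_laplacian (\<lambda>y. ln (s y)) z = ereal ((s z)\<^sup>2)"
      by (rule lower_laplacian_ln_of_liouville[OF open_ball zb Fh[OF zb] F1 nz[OF zb] R(4)])
    then show "curvature s z = -1"
      using spos[OF z] by (simp add: curvature_def one_ereal_def)
    show "log_subsolution_at s z" using lap by (simp add: log_subsolution_at_def)
    have "C2_on (ball z R) s"
      by (rule C2_on_cong_open[OF open_ball C2_on_liouville_density[OF open_ball Fh[OF zb] F1 nz]])
        (use R(4) in auto)
    then show "\<exists>U. open U \<and> z \<in> U \<and> C2_on U s" using zb open_ball by blast
  qed
  have pseudo: "conformal_pseudo_metric G s"
    unfolding conformal_pseudo_metric_def using sc s_nonneg spos assms(3) by (metis all_not_in_conv less_irrefl)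
  have SK: "SK_metric G s" unfolding SK_metric_iff using pseudo sub by blast
  have max: "maximal_SK_metric G s" unfolding maximal_SK_metric_def using SK le_s by blast
  have uniq: "m z = s z" if "maximal_SK_metric G m" "z \<in> G" for m z
    using that SK le_s unfolding maximal_SK_metric_def by (intro antisym) auto
  have "{z\<in>G. s z > 0} = G" using spos by blast
  then have reg: "regular_pseudo_metric G s"
    unfolding regular_pseudo_metric_def using pseudo C2_on_local[of G s, OF C2] by simp
  have conf: "conformal_metric G s" unfolding conformal_metric_def using pseudo spos by blast
  show ?thesis
    unfolding s_def[symmetric] by (intro conjI ballI allI impI bdd conf reg curv max uniq)
qed

end
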